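(* Let $\mathbf{R}$ be a strongly discrete coherent commutative ring with unit, let $n,m\ge 1$, let $\mathbf{R}[\underline{X}]=\mathbf{R}[X_1,\dots,X_n]$, and let $>$ be a monomial order on $\mathbf{H}_n^m=\mathbf{R}[\underline{X}]^m$. (1) (Buchberger's criterion) Let $f_1,\dots,f_p\in\mathbf{H}_n^m\setminus\{0\}$ ($p\ge1$), let $G=f_1,\dots,f_p$, and let $S_1,\dots,S_\ell\in\mathbf{R}[\underline{X}]^p$ be the list $S(\operatorname{LT}(f_1),\dots,\operatorname{LT}(f_p))$ of generators of $\operatorname{Syz}(\operatorname{LT}(f_1),\dots,\operatorname{LT}(f_p))$. Then $G$ is a Gröbner basis for $\langle f_1,\dots,f_p\rangle$ if and only if for every $1\le i\le\ell$ we have \[\overline{S_{i,1}f_1+\dots+S_{i,p}f_p}^{\,G}=0.\] (2) (Buchberger's algorithm works) Let $f_1,\dots,f_p\in\mathbf{H}_n^m\setminus\{0\}$ and $M=\langle f_1,\dots,f_p\rangle$. If the module of leading terms $\operatorname{MLT}(M)$ is finitely generated, then the generalised Buchberger algorithm with input $f_1,\dots,f_p$ computes (i.e. terminates after finitely many steps and returns) a Gröbner basis for $\langle f_1,\dots,f_p\rangle$.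
   Context: **Rings.** A ring $\mathbf{R}$ is strongly discrete if there is a membership test for finitely generated ideals: given $a,b_1,\dots,b_k$ one can decide whether $a\in\langle b_1,\dots,b_k\rangle$ and, if so, compute $c_i$ with $a=\sum b_ic_i$. (In particular equality is decidable.) For elements $v_1,\dots,v_k$ of an $A$-module, $\operatorname{Syz}(v_1,\dots,v_k)=\{(b_1,\dots,b_k)\in A^k : \sum b_iv_i=0\}$. $\mathbf{R}$ is coherent if the syzygy module of every finite family of elements of $\mathbf{R}$ is finitely generated (constructively: with algorithms computing generators and expressing syzygies in terms of them). We fix a certificate of coherence, i.e. a choice, for every finite family $(a_j)_{j\in E}$ in $\mathbf{R}$, of a finite list of generators of $\operatorname{Syz}((a_j)_{j\in E})$. $\langle\cdots\rangle$ denotes the submodule (or ideal) generated. **Monomials.** $(e_1,\dots,e_m)$ is the canonical basis of $\mathbf{H}_n^m$. A monomial of $\mathbf{H}_n^m$ is a vector $\underline{X}^\alpha e_i$; $i$ is its position. $\underline{X}^\alpha e_i$ divides $\underline{X}^\beta e_j$ if $i=j$ and $\underline{X}^\alpha$ divides $\underline{X}^\beta$; the quotient is then $\underline{X}^{\beta-\alpha}$. The lcm of monomials with the same position $i$ is the lcm of their $\underline{X}$-parts times $e_i$. A term is $cM$ with $c\in\mathbf{R}\setminus\{0\}$ and $M$ a monomial. A monomial order on $\mathbf{H}_n^m$ is a total order $>$ on its monomials such that $\underline{X}^\alpha M>M$ for all monomials $M$ and $\underline{X}^\alpha\ne1$, and $M>N\Rightarrow \underline{X}^\alpha M>\underline{X}^\alpha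 N$. A nonzero $u$ is uniquely $c_tM_t+\dots+c_1M_1$ with $c_i\ne0$ and monomials $M_t>\dots>M_1$ (the $c_iM_i$ are the terms of $u$); $\operatorname{LC}(u)=c_t$, $\operatorname{LM}(u)=M_t$, $\operatorname{LT}(u)=c_tM_t$; $\operatorname{LC}(0)=0$, $\operatorname{LM}(0)=0$, $\operatorname{LT}(0)=0$. For a polynomial $g\in\mathbf{R}[\underline{X}]$, $\operatorname{LM}(g)$ etc. are taken so that $\operatorname{LM}(g)\operatorname{LM}(h)=\max\{N\operatorname{LM}(h): N\text{ a monomial occurring in }g\}$ for the vector $h$ it multiplies. For a submodule $U$, $\operatorname{MLT}(U)=\langle \operatorname{LT}(u):u\in U\rangle$. A list $G=g_1,\dots,g_p$ of nonzero vectors is a Gröbner basis for $U=\langle G\rangle$ if $\operatorname{MLT}(U)=\langle \operatorname{LT}(g_1),\dots,\operatorname{LT}(g_p)\rangle$. **Division algorithm.** For $u\in\mathbf{H}_n^m$ and a list $H=h_1,\dots,h_p$ in $\mathbf{H}_n^m\setminus\{0\}$ it starts with $r=0$, $q_1=\dots=q_p=0$, and, while $u\ne0$, does the following: let $c=\operatorname{LC}(u)$, $M=\operatorname{LM}(u)$, $D=\{j:\operatorname{LM}(h_j)\mid M\}$. If $c\in\langle \operatorname{LC}(h_j): j\in D\rangle$, find $(a_j)_{j\in D}$ with $\sum_{j\in D}a_j\operatorname{LC}(h_j)=c$, replace $u$ by $u-\sum_{j\in D}a_j(M/\operatorname{LM}(h_j))h_j$ and each $q_j$, $j\in D$, by $q_j+a_jM/\operatorname{LM}(h_j)$.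 Otherwise replace $r$ by $r+cM$ and $u$ by $u-cM$. It returns $r,q_1,\dots,q_p$; for the original $u$ one has $u=q_1h_1+\dots+q_ph_p+r$, $\operatorname{LM}(u)\ge\operatorname{LM}(q_j)\operatorname{LM}(h_j)$ whenever $q_j\neq0$, and $T\notin\langle \operatorname{LT}(h_1),\dots,\operatorname{LT}(h_p)\rangle$ for each term $T$ of $r$. The vector $r$ is called a remainder of $u$ on division by $H$ and denoted $\overline{u}^{\,H}$; it may depend on the choices of the $a_j$, which are made arbitrarily. **Syzygies of terms.** Let $M_1,\dots,M_p$ be monomials and $a_1,\dots,a_p\in\mathbf{R}$. A position level set of $(M_1,\dots,M_p)$ is a nonempty $E\subseteq\{1,\dots,p\}$ such that all $M_j$, $j\in E$, have the same position. For such $E$ let $s^E_1,\dots,s^E_{\ell^E}$, $s^E_i=(s^E_{i,j})_{j\in E}$, be the list of generators of $\operatorname{Syz}((a_j)_{j\in E})$ given by the certificate of coherence; let $M^E=\operatorname{lcm}(M_j:j\in E)$ and $S^E_i=(S^E_{i,1},\dots,S^E_{i,p})\in\mathbf{R}[\underline{X}]^p$ with $S^E_{i,j}=s^E_{i,j}M^E/M_j$ if $j\in E$, $S^E_{i,j}=0$ otherwise. $S(a_1M_1,\dots,a_pM_p)$ is the concatenation of the lists $S^E_1,\dots,S^E_{\ell^E}$ over all position level sets $E$; its items generate $\operatorname{Syz}(a_1M_1,\dots,a_pM_p)\subseteq\mathbf{R}[\underline{X}]^p$. **S-list.** For a list $G=g_1,\dots,g_k$ of nonzero vectors, with $S_1,\dots,S_\ell$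 the list $S(\operatorname{LT}(g_1),\dots,\operatorname{LT}(g_k))$, $\mathscr{S}(G)$ is the list of the vectors $S_{i,1}g_1+\dots+S_{i,k}g_k$, $1\le i\le\ell$, with vanishing items deleted. **Generalised Buchberger algorithm.** Input $f_1,\dots,f_p\in\mathbf{H}_n^m\setminus\{0\}$. Start with $G=f_1,\dots,f_p$. Repeat: compute $\mathscr{S}(G)$; let $\mathscr{S}'$ be the list of the nonzero ones among the remainders $\overline{f}^{\,G}$, computed by the Division algorithm, of the items $f$ of $\mathscr{S}(G)$; if $\mathscr{S}'$ is nonempty, replace $G$ by the concatenation $G,\mathscr{S}'$; stop as soon as $\mathscr{S}'$ is empty. Return $G$. *)

theory Defs
  imports "HOL-Analysis.Analysis" "HOL-Library.Poly_Mapping"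
begin

text \<open>
  The indeterminates are indexed by a finite type \<open>'n\<close> and the coordinates of \<open>H = R[X]^m\<close> by a
  finite type \<open>'m\<close>. An exponent \<open>\<alpha>\<close> is a vector \<open>nat^'n\<close>, a polynomial is a finitely supported
  function from exponents to coefficients (with the convolution product of \<^theory>\<open>HOL-Library.Poly_Mapping\<close>),
  and the monomial \<open>X^\<alpha> e_i\<close> is encoded by the pair \<open>(\<alpha>, i)\<close>.
\<close>

type_synonym ('r, 'n) mpoly = "(nat^'n) \<Rightarrow>\<^sub>0 'r"
type_synonym ('r, 'n, 'm) hvec = "((nat^'n) \<Rightarrow>\<^sub>0 'r)^'m"
type_synonym ('n, 'm) mono = "(nat^'n) \<times> 'm"

lemma module_hvec:
  "module ((*s) :: ('r::comm_ring_1, 'n::finite) mpoly \<Rightarrow> ('r, 'n, 'm::finite) hvec \<Rightarrow> ('r, 'n, 'm) hvec)"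
  by unfold_locales (vector algebra_simps)+

lemma module_ring: "module ((*) :: 'r::comm_ring_1 \<Rightarrow> 'r \<Rightarrow> 'r)"
  by unfold_locales (simp_all add: algebra_simps)

abbreviation submodule_gen :: "('r::comm_ring_1, 'n::finite, 'm::finite) hvec set \<Rightarrow> ('r, 'n, 'm) hvec set"
  where "submodule_gen \<equiv> module.span (*s)"

abbreviation ideal_gen :: "'r::comm_ring_1 set \<Rightarrow> 'r set"
  where "ideal_gen \<equiv> module.span (*)"

definition finitely_generated :: "('r::comm_ring_1, 'n::finite, 'm::finite) hvec set \<Rightarrow> bool"
  where "finitely_generated U \<longleftrightarrow> (\<exists>B. finite B \<and> U = submodule_gen B)"


section \<open>Strongly discrete coherent rings\<close>

text \<open>
  Decidability has no content in classical logic, so the ring comes with its membership test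
  \<open>test\<close> as an explicit function.
\<close>

definition strongly_discrete :: "('r::comm_ring_1 \<Rightarrow> 'r list \<Rightarrow> 'r list option) \<Rightarrow> bool"
  where "strongly_discrete test \<longleftrightarrow>
    (\<forall>a bs. case test a bs of
        Some cs \<Rightarrow> length cs = length bs \<and> a = (\<Sum>i<length bs. bs ! i * cs ! i)
      | None \<Rightarrow> a \<notin> ideal_gen (set bs))"

text \<open>
  A family \<open>(a_j)\<close> indexed by \<open>E\<close> is represented by its extension by zero to all of \<^typ>\<open>nat\<close>.
\<close>

definition syz :: "nat set \<Rightarrow> (nat \<Rightarrow> 'r::comm_ring_1) \<Rightarrow> (nat \<Rightarrow> 'r) set"
  where "syz E a = {b. (\<forall>j. j \<notin> E \<longrightarrow> b j = 0) \<and> (\<Sum>j\<in>E. b j * a j) = 0}"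

definition coherence_certificate ::
    "(nat set \<Rightarrow> (nat \<Rightarrow> 'r::comm_ring_1) \<Rightarrow> (nat \<Rightarrow> 'r) list) \<Rightarrow> bool"
  where "coherence_certificate cert \<longleftrightarrow>
    (\<forall>E a. finite E \<and> (\<forall>j. j \<notin> E \<longrightarrow> a j = 0) \<longrightarrow>
      set (cert E a) \<subseteq> syz E a \<and>
      (\<forall>b\<in>syz E a. \<exists>c. \<forall>j. b j = (\<Sum>i<length (cert E a). c i * (cert E a ! i) j)))"


section \<open>Monomials and leading terms\<close>

definition mono_mult :: "nat^'n \<Rightarrow> ('n::finite, 'm) mono \<Rightarrow> ('n, 'm) mono"
  where "mono_mult \<gamma> M = (\<gamma> + fst M, snd M)"

definition mono_dvd :: "('n::finite, 'm) mono \<Rightarrow> ('n, 'm) mono \<Rightarrow> bool"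
  where "mono_dvd M N \<longleftrightarrow> snd M = snd N \<and> (\<forall>k. fst M $ k \<le> fst N $ k)"

text \<open>The argument \<open>gt\<close> is the strict order: \<open>gt M N\<close> means \<open>M > N\<close>.\<close>

definition monomial_order :: "(('n::finite, 'm::finite) mono \<Rightarrow> ('n, 'm) mono \<Rightarrow> bool) \<Rightarrow> bool"
  where "monomial_order gt \<longleftrightarrow>
    irreflp gt \<and> transp gt \<and> totalp gt \<and>
    (\<forall>\<gamma> M. \<gamma> \<noteq> 0 \<longrightarrow> gt (mono_mult \<gamma> M) M) \<and>
    (\<forall>\<gamma> M N. gt M N \<longrightarrow> gt (mono_mult \<gamma> M) (mono_mult \<gamma> N))"

definition vcoeff :: "('r::comm_ring_1, 'n::finite, 'm::finite) hvec \<Rightarrow> ('n, 'm) mono \<Rightarrow> 'r"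
  where "vcoeff u M = Poly_Mapping.lookup (u $ snd M) (fst M)"

definition vterm :: "'r::comm_ring_1 \<Rightarrow> ('n::finite, 'm::finite) mono \<Rightarrow> ('r, 'n, 'm) hvec"
  where "vterm c M = axis (snd M) (Poly_Mapping.single (fst M) c)"

text \<open>
  \<open>LM\<close> is meaningful only for nonzero vectors, since \<open>0\<close> is not a monomial; \<open>LC\<close> and \<open>LT\<close> vanish at \<open>0\<close>.
\<close>

definition LM :: "(('n::finite, 'm::finite) mono \<Rightarrow> ('n, 'm) mono \<Rightarrow> bool)
    \<Rightarrow> ('r::comm_ring_1, 'n, 'm) hvec \<Rightarrow> ('n, 'm) mono"
  where "LM gt u = (THE M. vcoeff u M \<noteq> 0 \<and> (\<forall>N. vcoeff u N \<noteq> 0 \<and> N \<noteq> M \<longrightarrow> gt M N))"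

definition LC :: "(('n::finite, 'm::finite) mono \<Rightarrow> ('n, 'm) mono \<Rightarrow> bool)
    \<Rightarrow> ('r::comm_ring_1, 'n, 'm) hvec \<Rightarrow> 'r"
  where "LC gt u = (if u = 0 then 0 else vcoeff u (LM gt u))"

definition LT :: "(('n::finite, 'm::finite) mono \<Rightarrow> ('n, 'm) mono \<Rightarrow> bool)
    \<Rightarrow> ('r::comm_ring_1, 'n, 'm) hvec \<Rightarrow> ('r, 'n, 'm) hvec"
  where "LT gt u = (if u = 0 then 0 else vterm (LC gt u) (LM gt u))"

definition MLT :: "(('n::finite, 'm::finite) mono \<Rightarrow> ('n, 'm) mono \<Rightarrow> bool)
    \<Rightarrow> ('r::comm_ring_1, 'n, 'm) hvec set \<Rightarrow> ('r, 'n, 'm) hvec set"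
  where "MLT gt U = submodule_gen (LT gt ` U)"

definition groebner_basis :: "(('n::finite, 'm::finite) mono \<Rightarrow> ('n, 'm) mono \<Rightarrow> bool)
    \<Rightarrow> ('r::comm_ring_1, 'n, 'm) hvec list \<Rightarrow> ('r, 'n, 'm) hvec set \<Rightarrow> bool"
  where "groebner_basis gt G U \<longleftrightarrow>
    0 \<notin> set G \<and> U = submodule_gen (set G) \<and> MLT gt U = submodule_gen (LT gt ` set G)"


section \<open>The division algorithm\<close>

text \<open>
  A state consists of the current \<open>u\<close>, the quotients \<open>q_j\<close> and the partial remainder \<open>r\<close>.
  The coefficients \<open>a_j\<close> of a reduction are chosen arbitrarily, whence a nondeterministic
  transition relation.
\<close>

definition divisors :: "(('n::finite, 'm::finite) mono \<Rightarrow> ('n, 'm) mono \<Rightarrow> bool)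
    \<Rightarrow> ('r::comm_ring_1, 'n, 'm) hvec list \<Rightarrow> ('n, 'm) mono \<Rightarrow> nat set"
  where "divisors gt H M = {j. j < length H \<and> mono_dvd (LM gt (H ! j)) M}"

definition quot_term :: "'r::comm_ring_1 \<Rightarrow> ('n::finite, 'm) mono \<Rightarrow> ('n, 'm) mono \<Rightarrow> ('r, 'n) mpoly"
  where "quot_term a M N = Poly_Mapping.single (fst M - fst N) a"

inductive division_step ::
    "(('n::finite, 'm::finite) mono \<Rightarrow> ('n, 'm) mono \<Rightarrow> bool) \<Rightarrow> ('r::comm_ring_1, 'n, 'm) hvec list
      \<Rightarrow> ('r, 'n, 'm) hvec \<times> (nat \<Rightarrow> ('r, 'n) mpoly) \<times> ('r, 'n, 'm) hvec
      \<Rightarrow> ('r, 'n, 'm) hvec \<times> (nat \<Rightarrow> ('r, 'n) mpoly) \<times> ('r, 'n, 'm) hvec \<Rightarrow> bool"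
  for gt H
  where
    reduce: "u \<noteq> 0 \<Longrightarrow> D = divisors gt H (LM gt u) \<Longrightarrow>
      LC gt u \<in> ideal_gen ((\<lambda>j. LC gt (H ! j)) ` D) \<Longrightarrow>
      (\<Sum>j\<in>D. a j * LC gt (H ! j)) = LC gt u \<Longrightarrow>
      division_step gt H (u, q, r)
        (u - (\<Sum>j\<in>D. quot_term (a j) (LM gt u) (LM gt (H ! j)) *s (H ! j)),
         (\<lambda>j. if j \<in> D then q j + quot_term (a j) (LM gt u) (LM gt (H ! j)) else q j),
         r)"
  | move: "u \<noteq> 0 \<Longrightarrow> D = divisors gt H (LM gt u) \<Longrightarrow>
      LC gt u \<notin> ideal_gen ((\<lambda>j. LC gt (H ! j)) ` D) \<Longrightarrow>
      division_step gt H (u, q, r) (u - LT gt u, q, r + LT gt u)"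

definition division_terminates :: "(('n::finite, 'm::finite) mono \<Rightarrow> ('n, 'm) mono \<Rightarrow> bool)
    \<Rightarrow> ('r::comm_ring_1, 'n, 'm) hvec list \<Rightarrow> ('r, 'n, 'm) hvec \<Rightarrow> bool"
  where "division_terminates gt H u \<longleftrightarrow> termip (division_step gt H) (u, \<lambda>_. 0, 0)"

definition is_remainder :: "(('n::finite, 'm::finite) mono \<Rightarrow> ('n, 'm) mono \<Rightarrow> bool)
    \<Rightarrow> ('r::comm_ring_1, 'n, 'm) hvec list \<Rightarrow> ('r, 'n, 'm) hvec \<Rightarrow> ('r, 'n, 'm) hvec \<Rightarrow> bool"
  where "is_remainder gt H u r \<longleftrightarrow>
    (\<exists>q. (division_step gt H)\<^sup>*\<^sup>* (u, \<lambda>_. 0, 0) (0, q, r))"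


section \<open>Syzygies of terms and S-lists\<close>

text \<open>
  Indices start at 0. The term \<open>a_j M_j\<close> is given by \<open>a j\<close> and \<open>M j\<close> for \<open>j < p\<close>, and an element of
  \<open>R[X]^p\<close> by a function on \<^typ>\<open>nat\<close> vanishing outside \<open>{..<p}\<close>. The position level sets, in some
  fixed order, are the sets \<open>set E\<close> for \<open>E\<close> in \<open>level_lists p M\<close>.
\<close>

definition level_lists :: "nat \<Rightarrow> (nat \<Rightarrow> ('n::finite, 'm) mono) \<Rightarrow> nat list list"
  where "level_lists p M =
    filter (\<lambda>E. E \<noteq> [] \<and> (\<forall>i\<in>set E. \<forall>j\<in>set E. snd (M i) = snd (M j))) (subseqs [0..<p])"

definition lcm_expo :: "nat set \<Rightarrow> (nat \<Rightarrow> ('n::finite, 'm) mono) \<Rightarrow> nat^'n"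
  where "lcm_expo E M = (\<chi> k. Max ((\<lambda>j. fst (M j) $ k) ` E))"

definition level_syzygies :: "(nat set \<Rightarrow> (nat \<Rightarrow> 'r::comm_ring_1) \<Rightarrow> (nat \<Rightarrow> 'r) list)
    \<Rightarrow> (nat \<Rightarrow> 'r) \<Rightarrow> (nat \<Rightarrow> ('n::finite, 'm) mono) \<Rightarrow> nat set \<Rightarrow> (nat \<Rightarrow> ('r, 'n) mpoly) list"
  where "level_syzygies cert a M E =
    map (\<lambda>s j. if j \<in> E then Poly_Mapping.single (lcm_expo E M - fst (M j)) (s j) else 0)
      (cert E (\<lambda>j. if j \<in> E then a j else 0))"

definition term_syzygies :: "(nat set \<Rightarrow> (nat \<Rightarrow> 'r::comm_ring_1) \<Rightarrow> (nat \<Rightarrow> 'r) list)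
    \<Rightarrow> nat \<Rightarrow> (nat \<Rightarrow> 'r) \<Rightarrow> (nat \<Rightarrow> ('n::finite, 'm) mono) \<Rightarrow> (nat \<Rightarrow> ('r, 'n) mpoly) list"
  where "term_syzygies cert p a M =
    concat (map (\<lambda>E. level_syzygies cert a M (set E)) (level_lists p M))"

definition LT_syzygies :: "(nat set \<Rightarrow> (nat \<Rightarrow> 'r::comm_ring_1) \<Rightarrow> (nat \<Rightarrow> 'r) list)
    \<Rightarrow> (('n::finite, 'm::finite) mono \<Rightarrow> ('n, 'm) mono \<Rightarrow> bool)
    \<Rightarrow> ('r, 'n, 'm) hvec list \<Rightarrow> (nat \<Rightarrow> ('r, 'n) mpoly) list"
  where "LT_syzygies cert gt G =
    term_syzygies cert (length G) (\<lambda>j. LC gt (G ! j)) (\<lambda>j. LM gt (G ! j))"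

definition lin_comb :: "(nat \<Rightarrow> ('r::comm_ring_1, 'n::finite) mpoly)
    \<Rightarrow> ('r, 'n, 'm::finite) hvec list \<Rightarrow> ('r, 'n, 'm) hvec"
  where "lin_comb S G = (\<Sum>j<length G. S j *s (G ! j))"

definition S_list :: "(nat set \<Rightarrow> (nat \<Rightarrow> 'r::comm_ring_1) \<Rightarrow> (nat \<Rightarrow> 'r) list)
    \<Rightarrow> (('n::finite, 'm::finite) mono \<Rightarrow> ('n, 'm) mono \<Rightarrow> bool)
    \<Rightarrow> ('r, 'n, 'm) hvec list \<Rightarrow> ('r, 'n, 'm) hvec list"
  where "S_list cert gt G = filter (\<lambda>v. v \<noteq> 0) (map (\<lambda>S. lin_comb S G) (LT_syzygies cert gt G))"


section \<open>The generalised Buchberger algorithm\<close>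

text \<open>\<open>round_output cert gt G S'\<close>: one round, started with \<open>G\<close>, can produce the list \<open>S'\<close>.\<close>

definition round_output :: "(nat set \<Rightarrow> (nat \<Rightarrow> 'r::comm_ring_1) \<Rightarrow> (nat \<Rightarrow> 'r) list)
    \<Rightarrow> (('n::finite, 'm::finite) mono \<Rightarrow> ('n, 'm) mono \<Rightarrow> bool)
    \<Rightarrow> ('r, 'n, 'm) hvec list \<Rightarrow> ('r, 'n, 'm) hvec list \<Rightarrow> bool"
  where "round_output cert gt G S' \<longleftrightarrow>
    (\<exists>rs. list_all2 (is_remainder gt G) (S_list cert gt G) rs \<and> S' = filter (\<lambda>v. v \<noteq> 0) rs)"

inductive buchberger_returns :: "(nat set \<Rightarrow> (nat \<Rightarrow> 'r::comm_ring_1) \<Rightarrow> (nat \<Rightarrow> 'r) list)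
    \<Rightarrow> (('n::finite, 'm::finite) mono \<Rightarrow> ('n, 'm) mono \<Rightarrow> bool)
    \<Rightarrow> ('r, 'n, 'm) hvec list \<Rightarrow> ('r, 'n, 'm) hvec list \<Rightarrow> bool"
  for cert gt
  where
    stop: "round_output cert gt G [] \<Longrightarrow> buchberger_returns cert gt G G"
  | continue: "round_output cert gt G S' \<Longrightarrow> S' \<noteq> [] \<Longrightarrow>
      buchberger_returns cert gt (G @ S') G' \<Longrightarrow> buchberger_returns cert gt G G'"

text \<open>
  Every run is finite, whatever choices are made; this covers both the number of rounds and the
  divisions performed in each of them.
\<close>

inductive buchberger_terminates :: "(nat set \<Rightarrow> (nat \<Rightarrow> 'r::comm_ring_1) \<Rightarrow> (nat \<Rightarrow> 'r) list)
    \<Rightarrow> (('n::finite, 'm::finite) mono \<Rightarrow> ('n, 'm) mono \<Rightarrow> bool)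
    \<Rightarrow> ('r, 'n, 'm) hvec list \<Rightarrow> bool"
  for cert gt
  where
    "(\<And>f. f \<in> set (S_list cert gt G) \<Longrightarrow> division_terminates gt G f) \<Longrightarrow>
     (\<And>S'. round_output cert gt G S' \<Longrightarrow> S' \<noteq> [] \<Longrightarrow> buchberger_terminates cert gt (G @ S')) \<Longrightarrow>
     buchberger_terminates cert gt G"

end

theory Submission
  imports Defs
begin

text \<open>
  Both parts rest on one descent. Write \<open>u\<close> in \<open>\<langle>G\<rangle>\<close> as \<open>\<Sum> q_j g_j\<close> and let \<open>\<delta>\<close> be the greatest of the
  monomials \<open>N LM(g_j)\<close> with \<open>N\<close> occurring in \<open>q_j\<close>. If \<open>\<delta>\<close> occurs in \<open>u\<close>, then \<open>\<delta> = LM(u)\<close> and \<open>LT(u)\<close> is a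
  combination of the \<open>LT(g_j)\<close> (\<open>LT_in_span_of_top\<close>). Otherwise the coefficients at \<open>\<delta>\<close> cancel, that
  is, they form a syzygy of the leading coefficients of the \<open>g_j\<close> with \<open>LM(g_j)\<close> dividing \<open>\<delta>\<close>. By
  coherence this syzygy is a combination of the chosen generators, so that the top part of the
  representation is a combination of multiples of S-vectors. The monomials of an S-vector lie
  strictly below the lcm it is built from; hence, once each S-vector has a representation bounded by
  its own leading monomial, \<open>u\<close> has a representation with all monomials below \<open>\<delta>\<close>
  (\<open>rep_lower_by_syzygies\<close>). The order is well-founded by Dickson's lemma (\<open>dickson\<close>, \<open>wfp_gt\<close>), so
  the descent ends.

  Division supplies the representations of the S-vectors: \<open>f - r\<close> is represented below any strict
  bound on the monomials of \<open>f\<close>, and \<open>LT(r)\<close> is never in \<open>\<langle>LT(g_j)\<rangle>\<close> unless \<open>r = 0\<close>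
  (\<open>remainder_bounded\<close>, \<open>remainder_LT_notin\<close>). If all remainders vanish, the descent stays within \<open>G\<close>
  and shows that \<open>G\<close> is a Groebner basis; conversely a remainder of an element of the module lies in
  the module, so that it vanishes when \<open>G\<close> is a Groebner basis.

  For the algorithm the descent is carried out along a sequence of lists \<open>G_0, G_1, \<dots>\<close> each of which
  extends its predecessor by the remainders found in one round: an S-vector of \<open>G_k\<close> is represented
  by \<open>G_{k+1}\<close>, because its remainder has been adjoined (\<open>round_output_rep\<close>,
  \<open>chain_leading_terms\<close>). The ring need not be Noetherian, so an ascending
  chain in a finitely generated module might fail to stabilise. The descent shows more: the
  union of the \<open>\<langle>LT(G_k)\<rangle>\<close> over an infinite run is all of \<open>MLT(M)\<close>. If this module is finitely generated,
  its generators lie in one \<open>\<langle>LT(G_K)\<rangle>\<close>, and a nonzero remainder of round \<open>K\<close> contradicts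
  \<open>remainder_LT_notin\<close>.
\<close>

section \<open>Linear combinations and coefficients of vectors\<close>

text \<open>
  Indexing the generators keeps separate coefficients for repeated entries of a list, which is the
  form in which quotients and syzygies occur.
\<close>

lemma (in module) span_indexed:
  assumes "finite A" and "x \<in> span (g ` A)"
  obtains a where "x = (\<Sum>i\<in>A. scale (a i) (g i))"
proof -
  let ?S = "range (\<lambda>a. \<Sum>i\<in>A. scale (a i) (g i))"
  have "subspace ?S"
  proof (rule subspaceI)
    show "0 \<in> ?S"
      by (rule range_eqI[of _ _ "\<lambda>_. 0"]) simp
    show "x + y \<in> ?S" if xy: "x \<in> ?S" "y \<in> ?S" for x y
    proof -
      obtain a b where "x = (\<Sum>i\<in>A. scale (a i) (g i))" "y = (\<Sum>i\<in>A. scale (b i) (g i))"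
        using xy by auto
      then show ?thesis
        by (intro range_eqI[of _ _ "\<lambda>i. a i + b i"]) (simp add: scale_left_distrib sum.distrib)
    qed
    show "scale c x \<in> ?S" if x: "x \<in> ?S" for c x
    proof -
      obtain a where "x = (\<Sum>i\<in>A. scale (a i) (g i))"
        using x by auto
      then show ?thesis
        by (intro range_eqI[of _ _ "\<lambda>i. c * a i"]) (simp add: scale_sum_right)
    qed
  qed
  moreover have "g ` A \<subseteq> ?S"
  proof (rule image_subsetI)
    fix j assume "j \<in> A"
    then have "g j = (\<Sum>i\<in>A. scale (if i = j then 1 else 0) (g i))"
      using \<open>finite A\<close> by (simp add: if_distrib[of "\<lambda>c. scale c _"] cong: if_cong)
    then show "g j \<in> ?S"
      by (rule range_eqI[of _ _ "\<lambda>i. if i = j then 1 else 0"])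
  qed
  ultimately have "span (g ` A) \<subseteq> ?S"
    by (rule span_minimal[rotated])
  then show ?thesis
    using assms(2) that by blast
qed

interpretation hvec: module "(*s) :: ('r::comm_ring_1, 'n::finite) mpoly \<Rightarrow> ('r, 'n, 'm::finite) hvec \<Rightarrow> _"
  by (rule module_hvec)

interpretation scalar: module "(*) :: 'r::comm_ring_1 \<Rightarrow> 'r \<Rightarrow> 'r"
  by (rule module_ring)

lemma vcoeff_zero [simp]: "vcoeff 0 M = 0"
  by (simp add: vcoeff_def)

lemma vcoeff_add [simp]: "vcoeff (u + v) M = vcoeff u M + vcoeff v M"
  by (simp add: vcoeff_def lookup_add)

lemma vcoeff_diff [simp]: "vcoeff (u - v) M = vcoeff u M - vcoeff v M"
  by (simp add: vcoeff_def lookup_minus)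

lemma vcoeff_sum: "vcoeff (\<Sum>i\<in>A. f i) M = (\<Sum>i\<in>A. vcoeff (f i) M)"
  by (induction A rule: infinite_finite_induct) simp_all

lemma vcoeff_vterm: "vcoeff (vterm c N) M = (c when M = N)"
  by (auto simp: vcoeff_def vterm_def axis_def lookup_single when_def prod_eq_iff)

lemma hvec_eqI: "u = v" if "\<And>M. vcoeff u M = vcoeff v M"
proof -
  have "Poly_Mapping.lookup (u $ i) \<alpha> = Poly_Mapping.lookup (v $ i) \<alpha>" for i \<alpha>
    using that[of "(\<alpha>, i)"] by (simp add: vcoeff_def)
  then show ?thesis
    by (simp add: vec_eq_iff poly_mapping_eqI)
qed

lemma finite_support: "finite {M. vcoeff u M \<noteq> 0}"
proof (rule finite_subset)
  show "{M. vcoeff u M \<noteq> 0} \<subseteq> (\<Union>i. (\<lambda>\<alpha>. (\<alpha>, i)) ` Poly_Mapping.keys (u $ i))"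
    by (fastforce simp: vcoeff_def in_keys_iff)
qed simp

lemma lookup_single_times:
  fixes p :: "('r::comm_ring_1, 'n::finite) mpoly"
  shows "Poly_Mapping.lookup (Poly_Mapping.single \<beta> c * p) \<alpha>
    = (if \<forall>k. \<beta> $ k \<le> \<alpha> $ k then c * Poly_Mapping.lookup p (\<alpha> - \<beta>) else 0)"
proof -
  have *: "\<alpha> = \<beta> + q \<longleftrightarrow> (\<forall>k. \<beta> $ k \<le> \<alpha> $ k) \<and> q = \<alpha> - \<beta>" for q :: "nat^'n"
    by (auto simp: vec_eq_iff)
  have "Poly_Mapping.lookup (Poly_Mapping.single \<beta> c * p) \<alpha>
      = Sum_any (\<lambda>l. c * Sum_any (\<lambda>q. Poly_Mapping.lookup p q when \<alpha> = \<beta> + q) when \<beta> = l)"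
    unfolding lookup_mult by (rule Sum_any.cong) (auto simp: lookup_single when_def)
  also have "\<dots> = c * Sum_any (\<lambda>q. Poly_Mapping.lookup p q when \<alpha> = \<beta> + q)"
    by simp
  also have "Sum_any (\<lambda>q. Poly_Mapping.lookup p q when \<alpha> = \<beta> + q)
      = Sum_any (\<lambda>q. (Poly_Mapping.lookup p q when (\<forall>k. \<beta> $ k \<le> \<alpha> $ k)) when q = \<alpha> - \<beta>)"
    by (rule Sum_any.cong) (simp add: * when_def)
  finally show ?thesis
    by (simp add: when_def)
qed

lemma vcoeff_single_smult:
  "vcoeff (Poly_Mapping.single \<beta> c *s u) (mono_mult \<beta> N) = c * vcoeff u N"
  by (simp add: vcoeff_def mono_mult_def lookup_single_times)

lemma vcoeff_single_smult_nonzeroE: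
  assumes "vcoeff (Poly_Mapping.single \<beta> c *s u) M \<noteq> 0"
  obtains N where "M = mono_mult \<beta> N" "vcoeff u N \<noteq> 0"
proof
  have "\<forall>k. \<beta> $ k \<le> fst M $ k" and nz: "c * vcoeff u (fst M - \<beta>, snd M) \<noteq> 0"
    using assms by (auto simp: vcoeff_def lookup_single_times split: if_splits)
  then show "M = mono_mult \<beta> (fst M - \<beta>, snd M)"
    by (auto simp: mono_mult_def prod_eq_iff vec_eq_iff)
  show "vcoeff u (fst M - \<beta>, snd M) \<noteq> 0"
    using nz by auto
qed

lemma single_smult_vterm:
  "Poly_Mapping.single \<beta> c *s vterm d N = vterm (c * d) (mono_mult \<beta> N)"
  by (auto simp: vec_eq_iff vterm_def axis_def mono_mult_def mult_single)

lemma vterm_sum: "vterm (\<Sum>i\<in>A. f i) M = (\<Sum>i\<in>A. vterm (f i) M)"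
  by (rule hvec_eqI) (simp add: vcoeff_sum vcoeff_vterm when_def)

lemma mpoly_eq_sum_singles:
  "p = (\<Sum>\<beta>\<in>Poly_Mapping.keys p. Poly_Mapping.single \<beta> (Poly_Mapping.lookup p \<beta>))"
  by (rule poly_mapping_eqI)
    (auto simp: lookup_sum lookup_single when_def in_keys_iff)

lemma single_sum: "Poly_Mapping.single \<alpha> (\<Sum>i\<in>A. f i) = (\<Sum>i\<in>A. Poly_Mapping.single \<alpha> (f i))"
  by (induction A rule: infinite_finite_induct) (simp_all add: single_add)

lemma lin_comb_add: "lin_comb (\<lambda>j. p j + q j) G = lin_comb p G + lin_comb q G"
  by (simp add: lin_comb_def hvec.scale_left_distrib sum.distrib)

lemma lin_comb_diff: "lin_comb (\<lambda>j. p j - q j) G = lin_comb p G - lin_comb q G"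
  by (simp add: lin_comb_def hvec.scale_left_diff_distrib sum_subtractf)

lemma lin_comb_smult: "lin_comb (\<lambda>j. c * p j) G = c *s lin_comb p G"
  by (simp add: lin_comb_def hvec.scale_sum_right)

lemma lin_comb_restrict:
  assumes "D \<subseteq> {..<length G}"
  shows "lin_comb (\<lambda>j. if j \<in> D then t j else 0) G = (\<Sum>j\<in>D. t j *s (G ! j))"
  unfolding lin_comb_def
  by (rule sum.mono_neutral_cong_right) (use assms in auto)

lemma lin_comb_in_span: "lin_comb q G \<in> submodule_gen (set G)"
  unfolding lin_comb_def by (intro hvec.span_sum hvec.span_scale hvec.span_base) auto

lemma coherence_certificateD:
  assumes "coherence_certificate cert" "finite E" "\<And>j. j \<notin> E \<Longrightarrow> a j = 0"
  shows "i < length (cert E a) \<Longrightarrow> cert E a ! i \<in> syz E a"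
    and "b \<in> syz E a \<Longrightarrow> \<exists>c. \<forall>j. b j = (\<Sum>i<length (cert E a). c i * (cert E a ! i) j)"
proof -
  have *: "set (cert E a) \<subseteq> syz E a \<and>
      (\<forall>b\<in>syz E a. \<exists>c. \<forall>j. b j = (\<Sum>i<length (cert E a). c i * (cert E a ! i) j))"
    using assms(1)[unfolded coherence_certificate_def, rule_format, of E a] assms(2,3) by simp
  show "i < length (cert E a) \<Longrightarrow> cert E a ! i \<in> syz E a"
    using * nth_mem by blast
  show "b \<in> syz E a \<Longrightarrow> \<exists>c. \<forall>j. b j = (\<Sum>i<length (cert E a). c i * (cert E a ! i) j)"
    using * by simp
qed


section \<open>Divisibility of monomials\<close>

lemma mono_dvd_quotient:
  assumes "mono_dvd N M"
  shows "mono_mult (fst M - fst N) N = M"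
  using assms by (auto simp: mono_dvd_def mono_mult_def prod_eq_iff vec_eq_iff)

lemma mono_dvd_mono_mult: "mono_dvd N (mono_mult \<beta> N)"
  by (simp add: mono_dvd_def mono_mult_def)

lemma mono_dvd_trans: "mono_dvd L M \<Longrightarrow> mono_dvd M N \<Longrightarrow> mono_dvd L N"
  unfolding mono_dvd_def by (auto intro: order_trans)

lemma mono_mult_assoc: "mono_mult \<alpha> (mono_mult \<beta> N) = mono_mult (\<alpha> + \<beta>) N"
  by (simp add: mono_mult_def add.assoc)

lemma mono_dvd_lcm_expo:
  assumes "finite E" "j \<in> E" "snd (M j) = i"
  shows "mono_dvd (M j) (lcm_expo E M, i)"
  using assms by (simp add: mono_dvd_def lcm_expo_def)

lemma lcm_expo_mono_dvd:
  assumes "finite E" "E \<noteq> {}" "\<And>j. j \<in> E \<Longrightarrow> mono_dvd (M j) N"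
  shows "mono_dvd (lcm_expo E M, snd N) N"
  using assms by (simp add: mono_dvd_def lcm_expo_def)


section \<open>Monomial orders are well-founded\<close>

lemma nat_seq_incseq_subseq:
  fixes s :: "nat \<Rightarrow> nat"
  obtains f :: "nat \<Rightarrow> nat" where "strict_mono f" "incseq (\<lambda>i. s (f i))"
proof -
  obtain f :: "nat \<Rightarrow> nat" where f: "strict_mono f" "monoseq (\<lambda>i. s (f i))"
    using seq_monosub[of s] by blast
  show ?thesis
  proof (cases "incseq (\<lambda>i. s (f i))")
    case True
    then show ?thesis using f that by blast
  next
    case False
    then have dec: "decseq (\<lambda>i. s (f i))"
      using f(2) by (auto simp: monoseq_iff)
    obtain N where N: "\<And>i. s (f N) \<le> s (f i)"
      using ex_has_least_nat[of "\<lambda>_. True" 0 "\<lambda>i. s (f i)"] by auto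
    \<comment> \<open>A decreasing sequence of natural numbers is constant from its minimum on.\<close>
    have "s (f (i + N)) = s (f N)" for i
      using N[of "i + N"] decseqD[OF dec, of N "i + N"] by simp
    then have "incseq (\<lambda>i. s (f (i + N)))"
      by (simp add: incseq_def)
    moreover have "strict_mono (\<lambda>i. f (i + N))"
      using f(1) by (simp add: strict_mono_def)
    ultimately show ?thesis using that by blast
  qed
qed

text \<open>
  Dickson's lemma: pass to subsequences that are monotone in one exponent after the other, then
  find two members with the same position by the pigeonhole principle.
\<close>

lemma dickson:
  fixes M :: "nat \<Rightarrow> ('n::finite, 'm::finite) mono"
  obtains i j where "i < j" "mono_dvd (M i) (M j)"
proof -
  have "\<exists>f. strict_mono f \<and> (\<forall>k\<in>K. incseq (\<lambda>i. fst (M (f i)) $ k))" if "finite K" for K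
    using that
  proof (induction K)
    case empty
    then show ?case by (auto intro!: exI[of _ id] simp: strict_mono_def)
  next
    case (insert k K)
    then obtain f where f: "strict_mono f" "\<forall>k\<in>K. incseq (\<lambda>i. fst (M (f i)) $ k)"
      by blast
    obtain g where g: "strict_mono g" "incseq (\<lambda>i. fst (M (f (g i))) $ k)"
      using nat_seq_incseq_subseq[of "\<lambda>i. fst (M (f i)) $ k"] by blast
    have "strict_mono (\<lambda>i. f (g i))"
      using f(1) g(1) by (simp add: strict_mono_def)
    moreover have "incseq (\<lambda>i. fst (M (f (g i))) $ l)" if "l \<in> K" for l
      using f(2) that g(1) by (auto simp: incseq_def strict_mono_less_eq)
    ultimately show ?case
      using g(2) by (intro exI[of _ "\<lambda>i. f (g i)"]) auto
  qed
  then obtain f where f: "strict_mono f" "\<And>k. incseq (\<lambda>i. fst (M (f i)) $ k)"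
    using finite[of "UNIV :: 'n set"] by blast
  have "\<not> inj (\<lambda>i. snd (M (f i)))"
    using finite_imageD[of "\<lambda>i. snd (M (f i))" UNIV] by auto
  then obtain i j where "i < j" "snd (M (f i)) = snd (M (f j))"
    unfolding inj_def by (metis linorder_neqE_nat)
  then show ?thesis
    using that[of "f i" "f j"] f by (auto simp: mono_dvd_def incseq_def strict_mono_less)
qed

locale mono_order =
  fixes gt :: "('n::finite, 'm::finite) mono \<Rightarrow> ('n, 'm) mono \<Rightarrow> bool"
  assumes monomial_order: "monomial_order gt"
begin

abbreviation ge :: "('n, 'm) mono \<Rightarrow> ('n, 'm) mono \<Rightarrow> bool"
  where "ge M N \<equiv> gt M N \<or> M = N"

lemma gt_irrefl [simp]: "\<not> gt M M"
  using monomial_order unfolding monomial_order_def irreflp_on_def by blast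

lemma gt_trans: "gt L M \<Longrightarrow> gt M N \<Longrightarrow> gt L N"
  using monomial_order unfolding monomial_order_def transp_def by blast

lemma gt_total: "gt M N \<or> M = N \<or> gt N M"
  using monomial_order unfolding monomial_order_def totalp_on_def by blast

lemma gt_mono_mult: "gt M N \<Longrightarrow> gt (mono_mult \<gamma> M) (mono_mult \<gamma> N)"
  using monomial_order unfolding monomial_order_def by blast

lemma mono_dvd_ge:
  assumes "mono_dvd N M"
  shows "ge M N"
proof (cases "fst M - fst N = 0")
  case True
  then have "M = mono_mult 0 N"
    using mono_dvd_quotient[OF assms] by simp
  then show ?thesis by (simp add: mono_mult_def)
next
  case False
  then have "gt (mono_mult (fst M - fst N) N) N"
    using monomial_order unfolding monomial_order_def by blast
  then show ?thesis by (simp add: mono_dvd_quotient[OF assms])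
qed

text \<open>
  A monomial that divides another is at most as large, so that an infinite descending sequence would
  contradict Dickson's lemma.
\<close>

lemma wfp_gt: "wfp (\<lambda>N M. gt M N)"
  unfolding wfp_def wf_iff_no_infinite_down_chain
proof
  assume "\<exists>f. \<forall>i. (f (Suc i), f i) \<in> {(N, M). gt M N}"
  then obtain f where f: "\<And>i. gt (f i) (f (Suc i))" by auto
  have "gt (f i) (f j)" if "i < j" for i j
    using that by (induction rule: less_Suc_induct) (auto intro: f gt_trans)
  moreover obtain i j where "i < j" "mono_dvd (f i) (f j)"
    by (rule dickson)
  ultimately show False
    using mono_dvd_ge gt_trans gt_irrefl by metis
qed

lemma finite_gt_max:
  assumes "finite A" "A \<noteq> {}"
  obtains M where "M \<in> A" "\<And>N. N \<in> A \<Longrightarrow> ge M N"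
proof -
  have "\<exists>M\<in>A. \<forall>N\<in>A. ge M N"
    using assms
  proof (induction rule: finite_ne_induct)
    case (insert x F)
    then obtain M where "M \<in> F" "\<forall>N\<in>F. ge M N" by blast
    then show ?case
      using gt_total[of x M] gt_trans by blast
  qed simp
  then show ?thesis using that by blast
qed


section \<open>Leading monomials\<close>

lemma LM_eqI:
  assumes "vcoeff u M \<noteq> 0" "\<And>N. vcoeff u N \<noteq> 0 \<Longrightarrow> ge M N"
  shows "LM gt u = M"
  unfolding LM_def
proof (rule the_equality)
  show "vcoeff u M \<noteq> 0 \<and> (\<forall>N. vcoeff u N \<noteq> 0 \<and> N \<noteq> M \<longrightarrow> gt M N)"
    using assms by auto
  show "M' = M" if "vcoeff u M' \<noteq> 0 \<and> (\<forall>N. vcoeff u N \<noteq> 0 \<and> N \<noteq> M' \<longrightarrow> gt M' N)" for M'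
    using that assms gt_trans gt_irrefl by metis
qed

lemma LM_properties:
  assumes "u \<noteq> 0"
  shows vcoeff_LM_nonzero: "vcoeff u (LM gt u) \<noteq> 0"
    and LM_ge: "vcoeff u N \<noteq> 0 \<Longrightarrow> ge (LM gt u) N"
proof -
  have "{M. vcoeff u M \<noteq> 0} \<noteq> {}"
  proof
    assume "{M. vcoeff u M \<noteq> 0} = {}"
    then have "u = 0" by (intro hvec_eqI) auto
    with assms show False by contradiction
  qed
  then obtain M where M: "vcoeff u M \<noteq> 0" "\<And>N. vcoeff u N \<noteq> 0 \<Longrightarrow> ge M N"
    by (rule finite_gt_max[OF finite_support[of u]]) blast
  then have "LM gt u = M" by (rule LM_eqI)
  with M show "vcoeff u (LM gt u) \<noteq> 0" "vcoeff u N \<noteq> 0 \<Longrightarrow> ge (LM gt u) N" by auto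
qed

lemma vcoeff_LM: "u \<noteq> 0 \<Longrightarrow> vcoeff u (LM gt u) = LC gt u"
  by (simp add: LC_def)

lemma LT_eq: "u \<noteq> 0 \<Longrightarrow> LT gt u = vterm (LC gt u) (LM gt u)"
  by (simp add: LT_def)

lemma vcoeff_LT_LM: "u \<noteq> 0 \<Longrightarrow> vcoeff (LT gt u) (LM gt u) = LC gt u"
  by (simp add: LT_eq vcoeff_vterm)

text \<open>
  A sum of multiples of the \<open>g j\<close> whose leading monomials are all shifted to the same \<open>\<mu>\<close>: the
  coefficient at \<open>\<mu>\<close> is a combination of leading coefficients, so a syzygy of these makes \<open>\<mu>\<close>
  disappear.
\<close>

lemma aligned_sum:
  fixes g :: "nat \<Rightarrow> ('r::comm_ring_1, 'n, 'm) hvec"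
  defines "t a D \<mu> \<equiv> \<Sum>j\<in>D. Poly_Mapping.single (fst \<mu> - fst (LM gt (g j))) (a j) *s g j"
  assumes "\<And>j. j \<in> D \<Longrightarrow> g j \<noteq> 0" "\<And>j. j \<in> D \<Longrightarrow> mono_dvd (LM gt (g j)) \<mu>"
  shows vcoeff_aligned_sum: "vcoeff (t a D \<mu>) \<mu> = (\<Sum>j\<in>D. a j * LC gt (g j))"
    and aligned_sum_ge: "vcoeff (t a D \<mu>) M \<noteq> 0 \<Longrightarrow> ge \<mu> M"
proof -
  let ?s = "\<lambda>j. Poly_Mapping.single (fst \<mu> - fst (LM gt (g j))) (a j) *s g j"
  have quot: "mono_mult (fst \<mu> - fst (LM gt (g j))) (LM gt (g j)) = \<mu>" if "j \<in> D" for j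
    using assms(3) that by (intro mono_dvd_quotient) auto
  have "vcoeff (?s j) \<mu> = a j * LC gt (g j)" if "j \<in> D" for j
    using vcoeff_single_smult[of "fst \<mu> - fst (LM gt (g j))" "a j" "g j" "LM gt (g j)"]
      quot[OF that] assms(2)[OF that] by (simp add: vcoeff_LM)
  then show "vcoeff (t a D \<mu>) \<mu> = (\<Sum>j\<in>D. a j * LC gt (g j))"
    by (simp add: t_def vcoeff_sum)
  assume "vcoeff (t a D \<mu>) M \<noteq> 0"
  then obtain j where j: "j \<in> D" "vcoeff (?s j) M \<noteq> 0"
    by (auto simp: t_def vcoeff_sum dest: sum.not_neutral_contains_not_neutral)
  obtain N where "M = mono_mult (fst \<mu> - fst (LM gt (g j))) N" "vcoeff (g j) N \<noteq> 0"
    using j(2) by (rule vcoeff_single_smult_nonzeroE)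
  then show "ge \<mu> M"
    using LM_ge[OF assms(2)[OF j(1)], of N] gt_mono_mult[of "LM gt (g j)" N] quot[OF j(1)]
    by metis
qed

text \<open>
  A submodule generated by terms is graded by the monomials; its component at \<open>M\<close> is the ideal
  generated by the coefficients of those generators whose monomial divides \<open>M\<close>.
\<close>

lemma vcoeff_span_LT:
  fixes H :: "('r::comm_ring_1, 'n, 'm) hvec list"
  assumes "0 \<notin> set H" and "v \<in> submodule_gen (LT gt ` set H)"
  shows "vcoeff v M \<in> ideal_gen ((\<lambda>j. LC gt (H ! j)) ` divisors gt H M)"
proof -
  let ?I = "\<lambda>M. ideal_gen ((\<lambda>j. LC gt (H ! j)) ` divisors gt H M)"
  let ?K = "{v. \<forall>M. vcoeff v M \<in> ?I M}"
  have single: "Poly_Mapping.single \<beta> c *s v \<in> ?K" if v: "v \<in> ?K" for \<beta> c v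
  proof safe
    fix \<alpha> :: "nat^'n" and i :: 'm
    let ?M = "(\<alpha>, i)"
    show "vcoeff (Poly_Mapping.single \<beta> c *s v) ?M \<in> ?I ?M"
    proof (cases "vcoeff (Poly_Mapping.single \<beta> c *s v) ?M = 0")
      case False
      then obtain N where N: "?M = mono_mult \<beta> N"
        by (rule vcoeff_single_smult_nonzeroE)
      have "divisors gt H N \<subseteq> divisors gt H ?M"
        unfolding N divisors_def by (auto intro: mono_dvd_trans[OF _ mono_dvd_mono_mult])
      then have "?I N \<subseteq> ?I ?M"
        by (intro scalar.span_mono image_mono)
      moreover have "vcoeff v N \<in> ?I N"
        using v by blast
      ultimately show ?thesis
        by (auto simp: N vcoeff_single_smult intro: scalar.span_scale)
    qed (simp add: scalar.span_zero)
  qed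
  have "hvec.subspace ?K"
  proof (rule hvec.subspaceI)
    show "0 \<in> ?K" by (simp add: scalar.span_zero)
    show add: "x + y \<in> ?K" if "x \<in> ?K" "y \<in> ?K" for x y
      using that by (simp add: scalar.span_add)
    show "p *s x \<in> ?K" if x: "x \<in> ?K" for p x
    proof -
      have "(\<Sum>\<beta>\<in>B. Poly_Mapping.single \<beta> (Poly_Mapping.lookup p \<beta>)) *s x \<in> ?K" if "finite B" for B
        using that
      proof (induction B)
        case (insert \<beta> B)
        then show ?case
          using add[OF single[OF x]] by (simp add: hvec.scale_left_distrib)
      qed (simp add: scalar.span_zero)
      then show ?thesis
        by (subst mpoly_eq_sum_singles[of p]) simp
    qed
  qed
  moreover have "LT gt ` set H \<subseteq> ?K"
  proof safe
    fix h and \<alpha> :: "nat^'n" and i :: 'm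
    assume "h \<in> set H"
    then obtain j where j: "j < length H" "h = H ! j"
      by (auto simp: in_set_conv_nth)
    with assms(1) have "h \<noteq> 0" by (metis nth_mem)
    let ?M = "(\<alpha>, i)"
    show "vcoeff (LT gt h) ?M \<in> ?I ?M"
    proof (cases "?M = LM gt h")
      case True
      then have "j \<in> divisors gt H ?M"
        using j by (simp add: divisors_def mono_dvd_def)
      then show ?thesis
        using \<open>h \<noteq> 0\<close> j True vcoeff_LT_LM[of h] by (auto intro: scalar.span_base)
    qed (simp add: LT_eq[OF \<open>h \<noteq> 0\<close>] vcoeff_vterm scalar.span_zero)
  qed
  ultimately have "submodule_gen (LT gt ` set H) \<subseteq> ?K"
    by (rule hvec.span_minimal[rotated])
  then show ?thesis using assms(2) by blast
qed


section \<open>Representations with bounded monomials\<close>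

text \<open>
  The monomials restricted here are the products of monomials of the \<open>q_j\<close> with the \<open>LM(g_j)\<close>. They may
  exceed \<open>LM(u)\<close>, and it is this excess that the descent removes.
\<close>

definition rep :: "('r::comm_ring_1, 'n, 'm) hvec list \<Rightarrow> (('n, 'm) mono \<Rightarrow> bool)
    \<Rightarrow> ('r, 'n, 'm) hvec \<Rightarrow> bool"
  where "rep G P u \<longleftrightarrow> (\<exists>q. u = lin_comb q G \<and>
    (\<forall>j<length G. \<forall>\<beta>. Poly_Mapping.lookup (q j) \<beta> \<noteq> 0 \<longrightarrow> P (mono_mult \<beta> (LM gt (G ! j)))))"

lemma rep_zero: "rep G P 0"
  unfolding rep_def by (rule exI[of _ "\<lambda>_. 0"]) (simp add: lin_comb_def)

lemma rep_add:
  assumes "rep G P u" "rep G P v"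
  shows "rep G P (u + v)"
proof -
  obtain p q where "u = lin_comb p G" "v = lin_comb q G"
    and P: "\<And>j \<beta>. j < length G \<Longrightarrow> Poly_Mapping.lookup (p j) \<beta> \<noteq> 0 \<Longrightarrow> P (mono_mult \<beta> (LM gt (G ! j)))"
      "\<And>j \<beta>. j < length G \<Longrightarrow> Poly_Mapping.lookup (q j) \<beta> \<noteq> 0 \<Longrightarrow> P (mono_mult \<beta> (LM gt (G ! j)))"
    using assms unfolding rep_def by blast
  then have "u + v = lin_comb (\<lambda>j. p j + q j) G"
    by (simp add: lin_comb_add)
  moreover have "P (mono_mult \<beta> (LM gt (G ! j)))"
    if "j < length G" "Poly_Mapping.lookup (p j + q j) \<beta> \<noteq> 0" for j \<beta>
    using that P[of j \<beta>] by (cases "Poly_Mapping.lookup (p j) \<beta> = 0") (auto simp: lookup_add)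
  ultimately show ?thesis
    unfolding rep_def by blast
qed

lemma rep_sum: "(\<And>i. i \<in> A \<Longrightarrow> rep G P (f i)) \<Longrightarrow> rep G P (\<Sum>i\<in>A. f i)"
  by (induction A rule: infinite_finite_induct) (auto intro: rep_zero rep_add)

lemma rep_single_smult:
  assumes "rep G P u" and PQ: "\<And>N. P N \<Longrightarrow> Q (mono_mult \<gamma> N)"
  shows "rep G Q (Poly_Mapping.single \<gamma> c *s u)"
proof -
  obtain q where u: "u = lin_comb q G"
    and P: "\<And>j \<beta>. j < length G \<Longrightarrow> Poly_Mapping.lookup (q j) \<beta> \<noteq> 0 \<Longrightarrow> P (mono_mult \<beta> (LM gt (G ! j)))"
    using assms unfolding rep_def by blast
  have "Q (mono_mult \<alpha> (LM gt (G ! j)))"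
    if "j < length G" "Poly_Mapping.lookup (Poly_Mapping.single \<gamma> c * q j) \<alpha> \<noteq> 0" for j \<alpha>
  proof -
    have "\<forall>k. \<gamma> $ k \<le> \<alpha> $ k" and nz: "Poly_Mapping.lookup (q j) (\<alpha> - \<gamma>) \<noteq> 0"
      using that(2) by (auto simp: lookup_single_times split: if_splits)
    then have "\<gamma> + (\<alpha> - \<gamma>) = \<alpha>"
      by (simp add: vec_eq_iff)
    then show ?thesis
      using PQ[OF P[OF that(1) nz]] by (simp add: mono_mult_assoc)
  qed
  then show ?thesis
    unfolding rep_def u
    by (intro exI[of _ "\<lambda>j. Poly_Mapping.single \<gamma> c * q j"]) (simp add: lin_comb_smult)
qed

lemma rep_append:
  assumes "rep G P u"
  shows "rep (G @ G') P u"
proof -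
  obtain q where u: "u = lin_comb q G"
    and P: "\<And>j \<beta>. j < length G \<Longrightarrow> Poly_Mapping.lookup (q j) \<beta> \<noteq> 0 \<Longrightarrow> P (mono_mult \<beta> (LM gt (G ! j)))"
    using assms unfolding rep_def by blast
  let ?q = "\<lambda>j. if j \<in> {..<length G} then q j else 0"
  have "lin_comb ?q (G @ G') = (\<Sum>j<length G. q j *s ((G @ G') ! j))"
    by (rule lin_comb_restrict) auto
  then have "u = lin_comb ?q (G @ G')"
    by (simp add: u lin_comb_def nth_append)
  then show ?thesis
    unfolding rep_def using P by (intro exI[of _ ?q]) (auto simp: nth_append)
qed

lemma rep_member:
  assumes "g \<in> set G" "P (LM gt g)"
  shows "rep G P g"
proof -
  obtain i where i: "i < length G" "g = G ! i"
    using assms(1) by (auto simp: in_set_conv_nth)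
  have "lin_comb (\<lambda>j. if j \<in> {i} then 1 else 0) G = g"
    using lin_comb_restrict[of "{i}" G "\<lambda>_. 1"] i by simp
  then show ?thesis
    unfolding rep_def using i assms(2)
    by (intro exI[of _ "\<lambda>j. if j \<in> {i} then 1 else 0"])
      (auto simp: lookup_one when_def mono_mult_def split: if_splits)
qed

lemma rep_imp_span: "rep G P u \<Longrightarrow> u \<in> submodule_gen (set G)"
  unfolding rep_def using lin_comb_in_span by blast

lemma span_imp_rep:
  assumes "u \<in> submodule_gen (set G)"
  shows "rep G (\<lambda>_. True) u"
proof -
  have "set G = (!) G ` {..<length G}"
    by (auto simp: in_set_conv_nth)
  then obtain q where "u = (\<Sum>j<length G. q j *s (G ! j))"
    using assms hvec.span_indexed[of "{..<length G}" u "(!) G"] by auto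
  then show ?thesis
    unfolding rep_def lin_comb_def by blast
qed

lemma rep_support:
  assumes "0 \<notin> set G" "rep G (gt \<delta>) u" "vcoeff u M \<noteq> 0"
  shows "gt \<delta> M"
proof -
  obtain q where u: "u = lin_comb q G"
    and q: "\<And>j \<beta>. j < length G \<Longrightarrow> Poly_Mapping.lookup (q j) \<beta> \<noteq> 0 \<Longrightarrow> gt \<delta> (mono_mult \<beta> (LM gt (G ! j)))"
    using assms(2) unfolding rep_def by blast
  obtain j where j: "j < length G" "vcoeff (q j *s (G ! j)) M \<noteq> 0"
    using assms(3) unfolding u lin_comb_def vcoeff_sum
    by (auto dest: sum.not_neutral_contains_not_neutral)
  have "vcoeff (\<Sum>\<beta>\<in>Poly_Mapping.keys (q j).
      Poly_Mapping.single \<beta> (Poly_Mapping.lookup (q j) \<beta>) *s (G ! j)) M \<noteq> 0"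
    using j(2) by (subst (asm) mpoly_eq_sum_singles[of "q j"]) (simp add: hvec.scale_sum_left)
  then obtain \<beta> where \<beta>: "\<beta> \<in> Poly_Mapping.keys (q j)"
    "vcoeff (Poly_Mapping.single \<beta> (Poly_Mapping.lookup (q j) \<beta>) *s (G ! j)) M \<noteq> 0"
    unfolding vcoeff_sum by (auto dest: sum.not_neutral_contains_not_neutral)
  obtain N where N: "M = mono_mult \<beta> N" "vcoeff (G ! j) N \<noteq> 0"
    using \<beta>(2) by (rule vcoeff_single_smult_nonzeroE)
  have "G ! j \<noteq> 0"
    using assms(1) j(1) by (metis nth_mem)
  then have "ge (mono_mult \<beta> (LM gt (G ! j))) M"
    using LM_ge[of "G ! j" N] N gt_mono_mult by metis
  moreover have "gt \<delta> (mono_mult \<beta> (LM gt (G ! j)))"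
    using q j(1) \<beta>(1) by (simp add: in_keys_iff)
  ultimately show ?thesis
    using gt_trans by blast
qed

lemma rep_maximal_monomial:
  assumes "rep G P u" "u \<noteq> 0"
  obtains \<delta> where "P \<delta>" "rep G (ge \<delta>) u"
proof -
  obtain q where u: "u = lin_comb q G"
    and q: "\<And>j \<beta>. j < length G \<Longrightarrow> Poly_Mapping.lookup (q j) \<beta> \<noteq> 0 \<Longrightarrow> P (mono_mult \<beta> (LM gt (G ! j)))"
    using assms(1) unfolding rep_def by blast
  define A where "A = (\<Union>j<length G. (\<lambda>\<beta>. mono_mult \<beta> (LM gt (G ! j))) ` Poly_Mapping.keys (q j))"
  have "finite A" by (simp add: A_def)
  moreover have "A \<noteq> {}"
  proof
    assume "A = {}"
    then have "\<forall>j<length G. q j = 0"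
      by (simp add: A_def)
    then have "u = 0"
      unfolding u lin_comb_def by (intro sum.neutral) simp
    with assms(2) show False by contradiction
  qed
  ultimately obtain \<delta> where \<delta>: "\<delta> \<in> A" "\<And>N. N \<in> A \<Longrightarrow> ge \<delta> N"
    by (rule finite_gt_max) blast
  have "P \<delta>"
    using \<delta>(1) q by (auto simp: A_def in_keys_iff)
  moreover have "ge \<delta> (mono_mult \<beta> (LM gt (G ! j)))"
    if "j < length G" "Poly_Mapping.lookup (q j) \<beta> \<noteq> 0" for j \<beta>
  proof (rule \<delta>(2))
    show "mono_mult \<beta> (LM gt (G ! j)) \<in> A"
      unfolding A_def using that by (intro UN_I[of j] image_eqI[of _ _ \<beta>]) (simp_all add: in_keys_iff)
  qed
  then have "rep G (ge \<delta>) u"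
    unfolding rep_def using u by blast
  ultimately show ?thesis
    using that by blast
qed

lemma finite_divisors: "finite (divisors gt H M)"
  by (simp add: divisors_def)

lemma divisors_nonzero: "0 \<notin> set H \<Longrightarrow> j \<in> divisors gt H M \<Longrightarrow> H ! j \<noteq> 0"
  by (metis (mono_tags, lifting) divisors_def mem_Collect_eq nth_mem)

lemma divisors_dvd: "j \<in> divisors gt H M \<Longrightarrow> mono_dvd (LM gt (H ! j)) M"
  by (simp add: divisors_def)

text \<open>
  At most one monomial of each \<open>q_j\<close> is multiplied by \<open>LM(g_j)\<close> to the bound \<open>\<delta>\<close>. Splitting these
  off leaves a representation strictly below \<open>\<delta>\<close>; the constants \<open>c j\<close> are their coefficients.
\<close>

lemma rep_split_top:
  assumes "rep G (ge \<delta>) u"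
  obtains c where "rep G (gt \<delta>)
    (u - (\<Sum>j\<in>divisors gt G \<delta>. Poly_Mapping.single (fst \<delta> - fst (LM gt (G ! j))) (c j) *s (G ! j)))"
proof -
  obtain q where u: "u = lin_comb q G"
    and q: "\<And>j \<beta>. j < length G \<Longrightarrow> Poly_Mapping.lookup (q j) \<beta> \<noteq> 0 \<Longrightarrow> ge \<delta> (mono_mult \<beta> (LM gt (G ! j)))"
    using assms unfolding rep_def by blast
  let ?D = "divisors gt G \<delta>"
  let ?e = "\<lambda>j. fst \<delta> - fst (LM gt (G ! j))"
  let ?t = "\<lambda>j. Poly_Mapping.single (?e j) (Poly_Mapping.lookup (q j) (?e j))"
  let ?q = "\<lambda>j. q j - (if j \<in> ?D then ?t j else 0)"
  have "u - (\<Sum>j\<in>?D. ?t j *s (G ! j)) = lin_comb ?q G"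
    unfolding u lin_comb_diff by (subst lin_comb_restrict) (auto simp: divisors_def)
  moreover have "gt \<delta> (mono_mult \<beta> (LM gt (G ! j)))"
    if j: "j < length G" and nz: "Poly_Mapping.lookup (?q j) \<beta> \<noteq> 0" for j \<beta>
  proof -
    have ne: "\<delta> \<noteq> mono_mult \<beta> (LM gt (G ! j))"
    proof
      assume \<delta>: "\<delta> = mono_mult \<beta> (LM gt (G ! j))"
      then have "j \<in> ?D"
        using j by (simp add: divisors_def mono_dvd_mono_mult)
      moreover have "?e j = \<beta>"
        by (simp add: \<delta> mono_mult_def)
      ultimately show False
        using nz by (simp add: lookup_minus)
    qed
    have "Poly_Mapping.lookup (q j) \<beta> \<noteq> 0"
    proof (cases "j \<in> ?D \<and> ?e j = \<beta>")
      case True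
      then show ?thesis
        using ne mono_dvd_quotient[OF divisors_dvd[of j G \<delta>]] by auto
    next
      case False
      then show ?thesis
        using nz by (auto simp: lookup_minus lookup_single when_def split: if_splits)
    qed
    then show ?thesis
      using q[OF j] ne by blast
  qed
  ultimately have "rep G (gt \<delta>) (u - (\<Sum>j\<in>?D. ?t j *s (G ! j)))"
    unfolding rep_def by blast
  then show ?thesis by (rule that)
qed


section \<open>Division\<close>

text \<open>
  In a reduction the coefficients at \<open>LM(u)\<close> cancel by the choice of the \<open>a_j\<close>, and every other monomial
  of the subtracted vector is smaller by \<open>aligned_sum_ge\<close>.
\<close>

lemma division_step_lowers:
  assumes "0 \<notin> set H" "division_step gt H (u, q, r) (u', q', r')" "vcoeff u' M \<noteq> 0"
  shows "gt (LM gt u) M"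
  using assms(2)
proof cases
  case (reduce D a)
  let ?t = "\<Sum>j\<in>D. quot_term (a j) (LM gt u) (LM gt (H ! j)) *s (H ! j)"
  have D: "H ! j \<noteq> 0" "mono_dvd (LM gt (H ! j)) (LM gt u)" if "j \<in> D" for j
  proof -
    have "j \<in> divisors gt H (LM gt u)"
      using that reduce(5) by simp
    then show "H ! j \<noteq> 0" "mono_dvd (LM gt (H ! j)) (LM gt u)"
      by (rule divisors_nonzero[OF assms(1)], rule divisors_dvd)
  qed
  have "vcoeff ?t (LM gt u) = vcoeff u (LM gt u)"
    unfolding quot_term_def
    by (subst vcoeff_aligned_sum) (use D reduce in \<open>auto simp: vcoeff_LM\<close>)
  then have "M \<noteq> LM gt u"
    using assms(3) reduce(1) by auto
  moreover have "vcoeff u M \<noteq> 0 \<or> vcoeff ?t M \<noteq> 0"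
    using assms(3) reduce(1) by auto
  then have "ge (LM gt u) M"
    using LM_ge[OF \<open>u \<noteq> 0\<close>] aligned_sum_ge[of D "\<lambda>j. H ! j" "LM gt u" a M, OF D]
    unfolding quot_term_def by blast
  ultimately show ?thesis by blast
next
  case (move D)
  then have "M \<noteq> LM gt u" "vcoeff u M \<noteq> 0"
    using assms(3) by (auto simp: LT_eq vcoeff_vterm vcoeff_LM when_def split: if_splits)
  then show ?thesis
    using LM_ge[OF \<open>u \<noteq> 0\<close>] by blast
qed

lemma division_step_exists:
  assumes "u \<noteq> 0"
  shows "\<exists>s. division_step gt H (u, q, r) s"
proof (cases "LC gt u \<in> ideal_gen ((\<lambda>j. LC gt (H ! j)) ` divisors gt H (LM gt u))")
  case True
  then obtain a where "LC gt u = (\<Sum>j\<in>divisors gt H (LM gt u). a j * LC gt (H ! j))"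
    by (rule scalar.span_indexed[OF finite_divisors])
  then show ?thesis
    using division_step.reduce[OF assms refl True, OF sym] by blast
next
  case False
  then show ?thesis
    using division_step.move[OF assms refl] by blast
qed

lemma division_terminates:
  assumes "0 \<notin> set H"
  shows "termip (division_step gt H) (u, q, r)"
proof -
  have zero: "termip (division_step gt H) (0, q, r)" for q r
    by (rule accp.accI) (auto elim: division_step.cases)
  have "u \<noteq> 0 \<Longrightarrow> LM gt u = \<delta> \<Longrightarrow> termip (division_step gt H) (u, q, r)" for \<delta>
  proof (induction \<delta> arbitrary: u q r rule: wfp_induct_rule[OF wfp_gt])
    case (1 \<delta>)
    show ?case
    proof (rule accp.accI)
      fix s assume "(division_step gt H)\<inverse>\<inverse> s (u, q, r)"
      moreover obtain u' q' r' where s: "s = (u', q', r')"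
        by (cases s) auto
      ultimately have step: "division_step gt H (u, q, r) (u', q', r')"
        by simp
      show "termip (division_step gt H) s"
      proof (cases "u' = 0")
        case False
        then have "gt \<delta> (LM gt u')"
          using division_step_lowers[OF assms step] vcoeff_LM_nonzero 1(3) by blast
        then show ?thesis
          using 1(1) False s by blast
      qed (simp add: s zero)
    qed
  qed
  then show ?thesis
    using zero by (cases "u = 0") auto
qed

lemma remainder_exists:
  assumes "0 \<notin> set H"
  shows "\<exists>r. is_remainder gt H f r"
proof -
  have "\<exists>q' r'. (division_step gt H)\<^sup>*\<^sup>* s (0, q', r')" for s
    using division_terminates[OF assms, of "fst s" "fst (snd s)" "snd (snd s)", simplified]
  proof (induction s rule: accp.induct)
    case (accI s)
    obtain u q r where s: "s = (u, q, r)"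
      by (cases s) auto
    show ?case
    proof (cases "u = 0")
      case True
      then show ?thesis using s by blast
    next
      case False
      then obtain s' where "division_step gt H s s'"
        using division_step_exists s by blast
      then show ?thesis
        using accI(2)[of s'] by (metis conversep_iff converse_rtranclp_into_rtranclp)
    qed
  qed
  then show ?thesis
    unfolding is_remainder_def by blast
qed

text \<open>
  The clause that the terms of \<open>r\<close> exceed all of \<open>u\<close> ensures that a coefficient moved to \<open>r\<close> is never
  altered afterwards, so that it stays outside the ideal that it was tested against. The quotients
  enter only through the existence of a representation of \<open>f - u - r\<close>.
\<close>

definition division_invariant :: "('r::comm_ring_1, 'n, 'm) hvec list \<Rightarrow> ('r, 'n, 'm) hvec
    \<Rightarrow> (('n, 'm) mono \<Rightarrow> bool) \<Rightarrow> ('r, 'n, 'm) hvec \<Rightarrow> ('r, 'n, 'm) hvec \<Rightarrow> bool"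
  where "division_invariant H f P u r \<longleftrightarrow>
    rep H P (f - u - r) \<and>
    (\<forall>M. vcoeff u M \<noteq> 0 \<longrightarrow> P M) \<and>
    (\<forall>M. vcoeff r M \<noteq> 0 \<longrightarrow> P M \<and> (\<forall>N. vcoeff u N \<noteq> 0 \<longrightarrow> gt M N) \<and>
      vcoeff r M \<notin> ideal_gen ((\<lambda>j. LC gt (H ! j)) ` divisors gt H M))"

lemma division_invariant_step:
  assumes H: "0 \<notin> set H" and P: "\<And>M N. P M \<Longrightarrow> gt M N \<Longrightarrow> P N"
    and inv: "division_invariant H f P u r"
    and step: "division_step gt H (u, q, r) (u', q', r')"
  shows "division_invariant H f P u' r'"
proof -
  have "u \<noteq> 0"
    using step by cases
  have PLM: "P (LM gt u)"
    using inv vcoeff_LM_nonzero[OF \<open>u \<noteq> 0\<close>] unfolding division_invariant_def by blast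
  have lower: "gt (LM gt u) M" if "vcoeff u' M \<noteq> 0" for M
    using division_step_lowers[OF H step that] .
  have Pu': "P M" if "vcoeff u' M \<noteq> 0" for M
    using P[OF PLM lower[OF that]] .
  have r_LM: "gt M (LM gt u)" if "vcoeff r M \<noteq> 0" for M
    using inv vcoeff_LM_nonzero[OF \<open>u \<noteq> 0\<close>] that unfolding division_invariant_def by blast
  have r_low: "gt M N" if "vcoeff r M \<noteq> 0" "vcoeff u' N \<noteq> 0" for M N
    using r_LM[OF that(1)] lower[OF that(2)] gt_trans by blast
  show ?thesis
    using step
  proof cases
    case (reduce D a)
    let ?t = "\<lambda>j. Poly_Mapping.single (fst (LM gt u) - fst (LM gt (H ! j))) (a j) *s (H ! j)"
    have "rep H P (?t j)" if "j \<in> D" for j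
    proof (rule rep_single_smult)
      show "rep H (\<lambda>N. N = LM gt (H ! j)) (H ! j)"
        using that reduce(5) by (intro rep_member) (simp_all add: divisors_def)
      show "P (mono_mult (fst (LM gt u) - fst (LM gt (H ! j))) N)" if "N = LM gt (H ! j)" for N
        using PLM mono_dvd_quotient[OF divisors_dvd, of j H "LM gt u"] that \<open>j \<in> D\<close> reduce(5)
        by simp
    qed
    then have "rep H P ((f - u - r) + (\<Sum>j\<in>D. ?t j))"
      using inv unfolding division_invariant_def by (intro rep_add rep_sum) auto
    moreover have "f - u' - r' = (f - u - r) + (\<Sum>j\<in>D. ?t j)"
      unfolding reduce(1,3) quot_term_def by (simp add: algebra_simps)
    ultimately have "rep H P (f - u' - r')" by (simp only:)
    then show ?thesis
      using inv Pu' r_low unfolding division_invariant_def reduce(3) by blast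
  next
    case (move D)
    have r0: "vcoeff r (LM gt u) = 0"
      using r_LM by fastforce
    have r': "vcoeff r' M = (if M = LM gt u then LC gt u else vcoeff r M)" for M
      using r0 move(3) by (simp add: LT_eq[OF \<open>u \<noteq> 0\<close>] vcoeff_vterm)
    have "f - u' - r' = f - u - r"
      unfolding move(1,3) by simp
    moreover have "P M \<and> (\<forall>N. vcoeff u' N \<noteq> 0 \<longrightarrow> gt M N) \<and>
        vcoeff r' M \<notin> ideal_gen ((\<lambda>j. LC gt (H ! j)) ` divisors gt H M)"
      if nz: "vcoeff r' M \<noteq> 0" for M
    proof (cases "M = LM gt u")
      case True
      then show ?thesis using PLM lower move(5,6) r' by simp
    next
      case False
      then have r: "vcoeff r M \<noteq> 0" "vcoeff r' M = vcoeff r M"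
        using nz r' by simp_all
      then show ?thesis
        using inv r_low unfolding division_invariant_def r(2) by blast
    qed
    ultimately show ?thesis
      using inv Pu' unfolding division_invariant_def by (simp only:) blast
  qed
qed

lemma is_remainder_invariant:
  assumes "0 \<notin> set H" "\<And>M N. P M \<Longrightarrow> gt M N \<Longrightarrow> P N"
    and "\<And>M. vcoeff f M \<noteq> 0 \<Longrightarrow> P M" "is_remainder gt H f r"
  shows "division_invariant H f P 0 r"
proof -
  have "division_invariant H f P (fst s) (snd (snd s))"
    if "(division_step gt H)\<^sup>*\<^sup>* (f, \<lambda>_. 0, 0) s" for s
    using that
  proof induction
    case base
    then show ?case
      using assms(3) by (simp add: division_invariant_def rep_zero)
  next
    case (step s s')
    obtain u q r u' q' r' where s: "s = (u, q, r)" "s' = (u', q', r')"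
      by (metis prod.exhaust)
    show ?case
      unfolding s fst_conv snd_conv
      by (rule division_invariant_step[OF assms(1,2) step(3)[unfolded s fst_conv snd_conv]
            step(2)[unfolded s]])
  qed
  then show ?thesis
    using assms(4) unfolding is_remainder_def by force
qed

text \<open>
  Bounds by an arbitrary \<open>\<delta>\<close>, in place of \<open>LM(f)\<close>, let the S-vectors, which are only known to lie
  strictly below an lcm, be treated without exception for \<open>f = 0\<close>.
\<close>

lemma remainder_bounded:
  assumes "0 \<notin> set H" "is_remainder gt H f r" "\<And>M. vcoeff f M \<noteq> 0 \<Longrightarrow> gt \<delta> M"
  shows "rep H (gt \<delta>) (f - r)" and "vcoeff r M \<noteq> 0 \<Longrightarrow> gt \<delta> M"
proof -
  have "division_invariant H f (gt \<delta>) 0 r"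
    using assms gt_trans by (intro is_remainder_invariant) auto
  then show "rep H (gt \<delta>) (f - r)" "vcoeff r M \<noteq> 0 \<Longrightarrow> gt \<delta> M"
    unfolding division_invariant_def diff_zero by blast+
qed

lemma remainder_diff_in_span:
  assumes "0 \<notin> set H" "is_remainder gt H f r"
  shows "f - r \<in> submodule_gen (set H)"
proof -
  have "division_invariant H f (\<lambda>_. True) 0 r"
    using assms by (intro is_remainder_invariant) simp_all
  then have "rep H (\<lambda>_. True) (f - r)"
    unfolding division_invariant_def diff_zero by blast
  then show ?thesis
    by (rule rep_imp_span)
qed

lemma remainder_LT_notin:
  assumes "0 \<notin> set H" "is_remainder gt H f r" "r \<noteq> 0"
  shows "LT gt r \<notin> submodule_gen (LT gt ` set H)"
proof
  assume "LT gt r \<in> submodule_gen (LT gt ` set H)"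
  then have "LC gt r \<in> ideal_gen ((\<lambda>j. LC gt (H ! j)) ` divisors gt H (LM gt r))"
    using vcoeff_span_LT[OF assms(1), of "LT gt r" "LM gt r"] vcoeff_LT_LM[OF assms(3)] by simp
  moreover have "division_invariant H f (\<lambda>_. True) 0 r"
    using assms(1,2) by (intro is_remainder_invariant) auto
  ultimately show False
    using vcoeff_LM_nonzero[OF assms(3)] vcoeff_LM[OF assms(3)]
    unfolding division_invariant_def by metis
qed


section \<open>Lowering a representation by syzygies\<close>

text \<open>
  No cancellation at the bound \<open>\<delta>\<close>: then \<open>\<delta>\<close> is the leading monomial, and the split-off part has the
  same leading term as \<open>u\<close>.
\<close>

lemma LT_in_span_of_top:
  assumes "0 \<notin> set G" "rep G (ge \<delta>) u" "vcoeff u \<delta> \<noteq> 0"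
  shows "LT gt u \<in> submodule_gen (LT gt ` set G)"
proof -
  let ?D = "divisors gt G \<delta>"
  obtain c where low: "rep G (gt \<delta>)
      (u - (\<Sum>j\<in>?D. Poly_Mapping.single (fst \<delta> - fst (LM gt (G ! j))) (c j) *s (G ! j)))"
    (is "rep G _ (u - ?t)")
    using assms(2) by (rule rep_split_top)
  note D = divisors_nonzero[OF assms(1), of _ \<delta>] divisors_dvd[of _ G \<delta>]
  have "vcoeff (u - ?t) \<delta> = 0"
    using rep_support[OF assms(1) low, of \<delta>] by auto
  then have u\<delta>: "vcoeff u \<delta> = (\<Sum>j\<in>?D. c j * LC gt (G ! j))"
    using vcoeff_aligned_sum[of ?D "\<lambda>j. G ! j" \<delta> c, OF D] by simp
  have "ge \<delta> M" if "vcoeff u M \<noteq> 0" for M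
  proof -
    have "vcoeff (u - ?t) M \<noteq> 0 \<or> vcoeff ?t M \<noteq> 0"
      using that by auto
    then show ?thesis
      using rep_support[OF assms(1) low] aligned_sum_ge[of ?D "\<lambda>j. G ! j" \<delta> c, OF D] by blast
  qed
  then have LM: "LM gt u = \<delta>"
    using assms(3) by (intro LM_eqI)
  have "u \<noteq> 0"
    using assms(3) by auto
  have "vterm (c j * LC gt (G ! j)) \<delta>
      = Poly_Mapping.single (fst \<delta> - fst (LM gt (G ! j))) (c j) *s LT gt (G ! j)" if "j \<in> ?D" for j
    using D[OF that] by (simp add: LT_eq single_smult_vterm mono_dvd_quotient)
  then have "LT gt u
      = (\<Sum>j\<in>?D. Poly_Mapping.single (fst \<delta> - fst (LM gt (G ! j))) (c j) *s LT gt (G ! j))"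
    using u\<delta> by (simp add: LT_eq[OF \<open>u \<noteq> 0\<close>] vcoeff_LM[OF \<open>u \<noteq> 0\<close>, symmetric] LM vterm_sum)
  also have "\<dots> \<in> submodule_gen (LT gt ` set G)"
    by (intro hvec.span_sum hvec.span_scale hvec.span_base) (auto simp: divisors_def)
  finally show ?thesis .
qed

text \<open>
  Cancellation at the bound \<open>\<delta>\<close>. With \<open>D\<close> the set of indices whose leading monomial divides \<open>\<delta>\<close>, the
  split-off part equals \<open>\<Sum>_i d_i (\<delta>/\<mu>) v_i\<close>, where \<open>\<mu>\<close> is the lcm for the level set \<open>D\<close>, the \<open>v_i\<close> are the
  S-vectors of that level set, and the \<open>d_i\<close> express the syzygy of the leading coefficients through
  the generators in the certificate. Each \<open>v_i\<close> lies below \<open>\<mu>\<close>, hence its multiple below \<open>\<delta>\<close>. The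
  representations of the S-vectors may use further vectors \<open>G'\<close>, as they do within the algorithm.
\<close>

lemma rep_lower_by_syzygies:
  assumes cert: "coherence_certificate cert" and nz: "0 \<notin> set G"
    and lift: "\<And>S \<delta>. S \<in> set (LT_syzygies cert gt G) \<Longrightarrow>
      (\<And>M. vcoeff (lin_comb S G) M \<noteq> 0 \<Longrightarrow> gt \<delta> M) \<Longrightarrow> rep (G @ G') (gt \<delta>) (lin_comb S G)"
    and "rep G (ge \<delta>) u" and "vcoeff u \<delta> = 0"
  shows "rep (G @ G') (gt \<delta>) u"
proof -
  let ?D = "divisors gt G \<delta>"
  let ?LM = "\<lambda>j. LM gt (G ! j)"
  obtain c where low: "rep G (gt \<delta>)
      (u - (\<Sum>j\<in>?D. Poly_Mapping.single (fst \<delta> - fst (?LM j)) (c j) *s (G ! j)))"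
    (is "rep G _ (u - ?t)")
    using assms(4) by (rule rep_split_top)
  note D = divisors_nonzero[OF nz, of _ \<delta>] divisors_dvd[of _ G \<delta>]
  have "vcoeff (u - ?t) \<delta> = 0"
    using rep_support[OF nz low, of \<delta>] by auto
  then have c0: "(\<Sum>j\<in>?D. c j * LC gt (G ! j)) = 0"
    using vcoeff_aligned_sum[of ?D "\<lambda>j. G ! j" \<delta> c, OF D] assms(5) by simp
  have "rep (G @ G') (gt \<delta>) ?t"
  proof (cases "?D = {}")
    case True
    then show ?thesis by (simp add: rep_zero)
  next
    case False
    have "?D \<in> set ` set (subseqs [0..<length G])"
      unfolding subseqs_powset by (auto simp: divisors_def)
    then obtain E where E: "E \<in> set (subseqs [0..<length G])" "set E = ?D"
      by auto
    have pos: "snd (?LM j) = snd \<delta>" if "j \<in> ?D" for j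
      using D(2)[OF that] by (simp add: mono_dvd_def)
    have "E \<in> set (level_lists (length G) ?LM)"
      unfolding level_lists_def using E False pos by auto
    define a where "a = (\<lambda>j. if j \<in> ?D then LC gt (G ! j) else 0)"
    define s where "s = cert ?D a"
    let ?b = "\<lambda>j. if j \<in> ?D then c j else 0"
    have b: "?b \<in> syz ?D a"
      using c0 by (auto simp: syz_def a_def cong: sum.cong)
    note certD = coherence_certificateD[OF cert finite_divisors, of G \<delta> a, folded s_def]
    have a0: "a j = 0" if "j \<notin> ?D" for j
      using that by (simp add: a_def)
    obtain d where d: "\<forall>j. ?b j = (\<Sum>i<length s. d i * (s ! i) j)"
      using certD(2)[OF a0 b] ..
    define \<mu> where "\<mu> = (lcm_expo ?D ?LM, snd \<delta>)"
    have \<mu>: "mono_dvd (?LM j) \<mu>" if "j \<in> ?D" for j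
      unfolding \<mu>_def by (rule mono_dvd_lcm_expo[where M = ?LM, OF finite_divisors that pos[OF that]])
    have \<mu>\<delta>: "mono_dvd \<mu> \<delta>"
      unfolding \<mu>_def by (rule lcm_expo_mono_dvd[where M = ?LM, OF finite_divisors False D(2)])
    define S where "S i = (\<lambda>j. if j \<in> ?D then Poly_Mapping.single (fst \<mu> - fst (?LM j)) ((s ! i) j) else 0)" for i
    have S_lin_comb: "lin_comb (S i) G
        = (\<Sum>j\<in>?D. Poly_Mapping.single (fst \<mu> - fst (?LM j)) ((s ! i) j) *s (G ! j))" for i
      unfolding S_def by (rule lin_comb_restrict) (auto simp: divisors_def)
    have step: "rep (G @ G') (gt \<delta>) (Poly_Mapping.single (fst \<delta> - fst \<mu>) (d i) *s lin_comb (S i) G)"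
      if i: "i < length s" for i
    proof (rule rep_single_smult)
      have "S i \<in> set (level_syzygies cert (\<lambda>j. LC gt (G ! j)) ?LM (set E))"
        unfolding level_syzygies_def E(2) a_def[symmetric] s_def[symmetric] S_def \<mu>_def fst_conv
        using i by (auto intro!: image_eqI[of _ _ "s ! i"])
      then have "S i \<in> set (LT_syzygies cert gt G)"
        unfolding LT_syzygies_def term_syzygies_def
        using \<open>E \<in> set (level_lists (length G) ?LM)\<close> by auto
      moreover have "gt \<mu> M" if M: "vcoeff (lin_comb (S i) G) M \<noteq> 0" for M
      proof -
        have "(\<Sum>j\<in>?D. (s ! i) j * LC gt (G ! j)) = (\<Sum>j\<in>?D. (s ! i) j * a j)"
          by (rule sum.cong) (simp_all add: a_def)
        also have "\<dots> = 0"
          using certD(1)[OF a0 i] unfolding syz_def by simp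
        finally have "vcoeff (lin_comb (S i) G) \<mu> = 0"
          unfolding S_lin_comb
          using vcoeff_aligned_sum[of ?D "\<lambda>j. G ! j" \<mu> "s ! i", OF D(1) \<mu>] by simp
        then have "M \<noteq> \<mu>"
          using M by blast
        moreover have "ge \<mu> M"
          using aligned_sum_ge[of ?D "\<lambda>j. G ! j" \<mu> "s ! i" M, OF D(1) \<mu>] M
          unfolding S_lin_comb by simp
        ultimately show ?thesis by simp
      qed
      ultimately show "rep (G @ G') (gt \<mu>) (lin_comb (S i) G)"
        by (rule lift)
      show "gt \<delta> (mono_mult (fst \<delta> - fst \<mu>) N)" if "gt \<mu> N" for N
        using gt_mono_mult[OF that, of "fst \<delta> - fst \<mu>"] mono_dvd_quotient[OF \<mu>\<delta>] by simp
    qed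
    \<comment> \<open>The truncated subtraction of exponents is harmless since each monomial divides the next.\<close>
    have expo: "(fst \<delta> - fst \<mu>) + (fst \<mu> - fst (?LM j)) = fst \<delta> - fst (?LM j)" if "j \<in> ?D" for j
      using \<mu>[OF that] \<mu>\<delta> by (auto simp: mono_dvd_def vec_eq_iff)
    have "(\<Sum>i<length s. Poly_Mapping.single (fst \<delta> - fst \<mu>) (d i) *s lin_comb (S i) G)
        = (\<Sum>i<length s. \<Sum>j\<in>?D. Poly_Mapping.single (fst \<delta> - fst (?LM j)) (d i * (s ! i) j) *s (G ! j))"
      unfolding S_lin_comb hvec.scale_sum_right
      by (intro sum.cong refl) (simp add: mult_single expo)
    also have "\<dots> = (\<Sum>j\<in>?D. \<Sum>i<length s. Poly_Mapping.single (fst \<delta> - fst (?LM j)) (d i * (s ! i) j) *s (G ! j))"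
      by (rule sum.swap)
    also have "\<dots> = ?t"
    proof (rule sum.cong[OF refl])
      fix j assume "j \<in> ?D"
      then have "c j = (\<Sum>i<length s. d i * (s ! i) j)"
        using d[rule_format, of j] by simp
      then show "(\<Sum>i<length s. Poly_Mapping.single (fst \<delta> - fst (?LM j)) (d i * (s ! i) j) *s (G ! j))
          = Poly_Mapping.single (fst \<delta> - fst (?LM j)) (c j) *s (G ! j)"
        by (simp add: single_sum hvec.scale_sum_left)
    qed
    finally have "?t = (\<Sum>i<length s. Poly_Mapping.single (fst \<delta> - fst \<mu>) (d i) *s lin_comb (S i) G)"
      by (rule sym)
    moreover have "rep (G @ G') (gt \<delta>)
        (\<Sum>i<length s. Poly_Mapping.single (fst \<delta> - fst \<mu>) (d i) *s lin_comb (S i) G)"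
      by (rule rep_sum) (simp add: step)
    ultimately show ?thesis
      by (simp only:)
  qed
  then have "rep (G @ G') (gt \<delta>) ((u - ?t) + ?t)"
    using rep_append[OF low] by (rule rep_add[rotated])
  then show ?thesis by simp
qed

text \<open>
  Each descent step passes from one list to the next. The constant sequence gives the criterion, an
  infinite run of the algorithm gives the termination argument. The index reached depends on \<open>u\<close>, so
  without a finiteness hypothesis no single list need suffice.
\<close>

lemma chain_leading_terms:
  fixes G :: "nat \<Rightarrow> ('r::comm_ring_1, 'n, 'm) hvec list"
  assumes cert: "coherence_certificate cert" and nz: "\<And>k. 0 \<notin> set (G k)"
    and ext: "\<And>k. G (Suc k) = G k @ G' k"
    and lift: "\<And>k S \<delta>. S \<in> set (LT_syzygies cert gt (G k)) \<Longrightarrow>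
      (\<And>M. vcoeff (lin_comb S (G k)) M \<noteq> 0 \<Longrightarrow> gt \<delta> M) \<Longrightarrow>
      rep (G (Suc k)) (gt \<delta>) (lin_comb S (G k))"
    and u: "u \<in> submodule_gen (set (G 0))" "u \<noteq> 0"
  shows "\<exists>k. LT gt u \<in> submodule_gen (LT gt ` set (G k))"
proof -
  have *: "\<exists>k. LT gt u \<in> submodule_gen (LT gt ` set (G k))" if "rep (G k) (ge \<delta>) u" for k \<delta>
    using that
  proof (induction \<delta> arbitrary: k rule: wfp_induct_rule[OF wfp_gt])
    case (1 \<delta>)
    show ?case
    proof (cases "vcoeff u \<delta> = 0")
      case True
      have "rep (G (Suc k)) (gt \<delta>) u"
        unfolding ext
      proof (rule rep_lower_by_syzygies[OF cert nz _ 1(2) True])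
        fix S \<delta>'
        assume "S \<in> set (LT_syzygies cert gt (G k))"
          and "\<And>M. vcoeff (lin_comb S (G k)) M \<noteq> 0 \<Longrightarrow> gt \<delta>' M"
        then show "rep (G k @ G' k) (gt \<delta>') (lin_comb S (G k))"
          unfolding ext[symmetric] by (rule lift)
      qed
      then obtain \<delta>' where "gt \<delta> \<delta>'" "rep (G (Suc k)) (ge \<delta>') u"
        using u(2) by (rule rep_maximal_monomial)
      then show ?thesis
        by (rule 1(1))
    next
      case False
      then show ?thesis
        using LT_in_span_of_top[OF nz 1(2)] by blast
    qed
  qed
  obtain \<delta> where "rep (G 0) (ge \<delta>) u"
    using span_imp_rep[OF u(1)] u(2) by (rule rep_maximal_monomial)
  then show ?thesis by (rule *)
qed


section \<open>Buchberger's criterion\<close>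

lemma groebner_basisI:
  assumes "coherence_certificate cert" "0 \<notin> set G"
    and "\<And>S \<delta>. S \<in> set (LT_syzygies cert gt G) \<Longrightarrow>
      (\<And>M. vcoeff (lin_comb S G) M \<noteq> 0 \<Longrightarrow> gt \<delta> M) \<Longrightarrow> rep G (gt \<delta>) (lin_comb S G)"
  shows "groebner_basis gt G (submodule_gen (set G))"
proof -
  let ?U = "submodule_gen (set G)"
  have "LT gt u \<in> submodule_gen (LT gt ` set G)" if "u \<in> ?U" for u
  proof (cases "u = 0")
    case True
    then show ?thesis by (simp add: LT_def hvec.span_zero)
  next
    case False
    then show ?thesis
      using chain_leading_terms[of cert "\<lambda>_. G" "\<lambda>_. []" u] assms that by simp
  qed
  then have "submodule_gen (LT gt ` ?U) \<subseteq> submodule_gen (LT gt ` set G)"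
    by (intro hvec.span_minimal) (auto simp: hvec.subspace_span)
  moreover have "submodule_gen (LT gt ` set G) \<subseteq> submodule_gen (LT gt ` ?U)"
    by (intro hvec.span_mono image_mono hvec.span_superset)
  ultimately show ?thesis
    using assms(2) by (simp add: groebner_basis_def MLT_def)
qed

text \<open>
  The remainder lies in the module along with \<open>f\<close>, so its leading term would have to be generated by
  the \<open>LT(g_j)\<close>.
\<close>

lemma groebner_basis_remainder_zero:
  assumes "groebner_basis gt G U" "f \<in> U" "is_remainder gt G f r"
  shows "r = 0"
proof (rule ccontr)
  assume "r \<noteq> 0"
  have G: "0 \<notin> set G" "U = submodule_gen (set G)"
    "submodule_gen (LT gt ` U) = submodule_gen (LT gt ` set G)"
    using assms(1) unfolding groebner_basis_def MLT_def by blast+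
  have "f - (f - r) \<in> U"
    using remainder_diff_in_span[OF G(1) assms(3)] assms(2) unfolding G(2) by (rule hvec.span_diff[rotated])
  then have "LT gt r \<in> submodule_gen (LT gt ` set G)"
    unfolding G(3)[symmetric] by (intro hvec.span_base imageI) simp
  then show False
    using remainder_LT_notin[OF G(1) assms(3) \<open>r \<noteq> 0\<close>] by contradiction
qed

lemma groebner_basis_iff_remainders_zero:
  assumes "coherence_certificate cert" "0 \<notin> set G"
    and rs: "list_all2 (\<lambda>S r. is_remainder gt G (lin_comb S G) r) (LT_syzygies cert gt G) rs"
  shows "groebner_basis gt G (submodule_gen (set G)) \<longleftrightarrow> (\<forall>i<length rs. rs ! i = 0)"
proof
  assume "groebner_basis gt G (submodule_gen (set G))"
  then show "\<forall>i<length rs. rs ! i = 0"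
    using rs lin_comb_in_span by (metis groebner_basis_remainder_zero list_all2_nthD2)
next
  assume zero: "\<forall>i<length rs. rs ! i = 0"
  show "groebner_basis gt G (submodule_gen (set G))"
  proof (rule groebner_basisI[OF assms(1,2)])
    fix S \<delta> assume "S \<in> set (LT_syzygies cert gt G)"
      and low: "\<And>M. vcoeff (lin_comb S G) M \<noteq> 0 \<Longrightarrow> gt \<delta> M"
    then have "is_remainder gt G (lin_comb S G) 0"
      using rs zero by (metis in_set_conv_nth list_all2_conv_all_nth)
    then show "rep G (gt \<delta>) (lin_comb S G)"
      using remainder_bounded(1)[OF assms(2) _ low] by fastforce
  qed
qed

lemma remainders_exist:
  assumes "0 \<notin> set G"
  shows "\<exists>rs. list_all2 (\<lambda>x r. is_remainder gt G (f x) r) xs rs"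
proof
  show "list_all2 (\<lambda>x r. is_remainder gt G (f x) r) xs (map (\<lambda>x. SOME r. is_remainder gt G (f x) r) xs)"
    using remainder_exists[OF assms] by (auto simp: list_all2_conv_all_nth intro: someI_ex)
qed


section \<open>The generalised Buchberger algorithm\<close>

lemma round_output_exists: "0 \<notin> set G \<Longrightarrow> \<exists>S'. round_output cert gt G S'"
  unfolding round_output_def using remainders_exist[of G "\<lambda>x. x"] by blast

lemma round_output_member:
  assumes "round_output cert gt G S'" "r \<in> set S'"
  obtains f where "f \<in> set (S_list cert gt G)" "is_remainder gt G f r" "r \<noteq> 0"
proof -
  obtain rs where rs: "list_all2 (is_remainder gt G) (S_list cert gt G) rs" "S' = filter (\<lambda>v. v \<noteq> 0) rs"
    using assms(1) unfolding round_output_def by blast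
  then obtain i where i: "i < length rs" "r = rs ! i" "r \<noteq> 0"
    using assms(2) by (auto simp: in_set_conv_nth)
  then show ?thesis
    using that[of "S_list cert gt G ! i"] rs(1) by (auto simp: list_all2_conv_all_nth)
qed

text \<open>
  A nonzero remainder represents itself as soon as it has been adjoined, and division bounds it by
  the same \<open>\<delta>\<close>.
\<close>

lemma round_output_rep:
  assumes round: "round_output cert gt G S'" and nz: "0 \<notin> set G"
    and S: "S \<in> set (LT_syzygies cert gt G)"
    and low: "\<And>M. vcoeff (lin_comb S G) M \<noteq> 0 \<Longrightarrow> gt \<delta> M"
  shows "rep (G @ S') (gt \<delta>) (lin_comb S G)"
proof (cases "lin_comb S G = 0")
  case True
  then show ?thesis by (simp add: rep_zero)
next
  case False
  obtain rs where rs: "list_all2 (is_remainder gt G) (S_list cert gt G) rs" "S' = filter (\<lambda>v. v \<noteq> 0) rs"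
    using round unfolding round_output_def by blast
  have "lin_comb S G \<in> set (S_list cert gt G)"
    using S False unfolding S_list_def by simp
  then obtain i where "i < length rs" "is_remainder gt G (lin_comb S G) (rs ! i)"
    using rs(1) by (auto simp: in_set_conv_nth list_all2_conv_all_nth)
  then obtain r where r: "r \<in> set rs" "is_remainder gt G (lin_comb S G) r"
    by (metis nth_mem)
  have 1: "rep (G @ S') (gt \<delta>) (lin_comb S G - r)"
    by (intro rep_append remainder_bounded(1)[OF nz r(2) low])
  have 2: "rep (G @ S') (gt \<delta>) r"
  proof (cases "r = 0")
    case True
    then show ?thesis by (simp add: rep_zero)
  next
    case False
    then have "gt \<delta> (LM gt r)"
      using remainder_bounded(2)[OF nz r(2) low] vcoeff_LM_nonzero by blast
    then show ?thesis
      using False r(1) rs(2) by (intro rep_member) auto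
  qed
  show ?thesis
    using rep_add[OF 1 2] by simp
qed

lemma round_output_append:
  assumes "round_output cert gt G S'" "0 \<notin> set G"
  shows round_output_nonzero: "0 \<notin> set (G @ S')"
    and round_output_span: "submodule_gen (set (G @ S')) = submodule_gen (set G)"
proof -
  show "0 \<notin> set (G @ S')"
    using assms by (auto simp: round_output_def)
  have "r \<in> submodule_gen (set G)" if r: "r \<in> set S'" for r
  proof -
    obtain f where f: "f \<in> set (S_list cert gt G)" "is_remainder gt G f r"
      using round_output_member[OF assms(1) r] by blast
    have "f \<in> submodule_gen (set G)"
      using f(1) lin_comb_in_span unfolding S_list_def by auto
    then have "f - (f - r) \<in> submodule_gen (set G)"
      using remainder_diff_in_span[OF assms(2) f(2)] by (rule hvec.span_diff)
    then show ?thesis by simp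
  qed
  then have "set (G @ S') \<subseteq> submodule_gen (set G)"
    by (auto intro: hvec.span_base)
  then show "submodule_gen (set (G @ S')) = submodule_gen (set G)"
    by (intro subset_antisym hvec.span_minimal hvec.span_mono) (auto simp: hvec.subspace_span)
qed

lemma buchberger_returns_groebner:
  assumes "coherence_certificate cert" "buchberger_returns cert gt G G'" "0 \<notin> set G"
  shows "groebner_basis gt G' (submodule_gen (set G))"
  using assms(2,3)
proof (induction rule: buchberger_returns.induct)
  case (stop G)
  then show ?case
    using round_output_rep[OF stop(1,2)] by (intro groebner_basisI[OF assms(1)]) auto
next
  case (continue G S' G')
  then show ?case
    using round_output_append[OF continue(1)] by simp
qed

lemma buchberger_returns_exists:
  assumes "buchberger_terminates cert gt G" "0 \<notin> set G"
  shows "\<exists>G'. buchberger_returns cert gt G G'"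
  using assms
proof (induction rule: buchberger_terminates.induct)
  case (1 G)
  obtain S' where S': "round_output cert gt G S'"
    using round_output_exists 1(4) by blast
  show ?case
  proof (cases "S' = []")
    case True
    then show ?thesis
      using S' buchberger_returns.stop by blast
  next
    case False
    then show ?thesis
      using 1(3)[OF S'] round_output_nonzero[OF S' 1(4)] buchberger_returns.continue[OF S'] by blast
  qed
qed

text \<open>
  Divisions always end, so a run that does not end consists of infinitely many rounds with nonzero
  remainders.
\<close>

lemma buchberger_terminates_if_MLT_fg:
  fixes fs :: "('r::comm_ring_1, 'n, 'm) hvec list"
  assumes cert: "coherence_certificate cert" and nz: "0 \<notin> set fs"
    and fg: "finitely_generated (MLT gt (submodule_gen (set fs)))"
  shows "buchberger_terminates cert gt fs"
proof (rule ccontr)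
  assume not_term: "\<not> buchberger_terminates cert gt fs"
  let ?U = "submodule_gen (set fs)"
  let ?P = "\<lambda>G. \<not> buchberger_terminates cert gt G \<and> 0 \<notin> set G \<and> submodule_gen (set G) = ?U"
  let ?Q = "\<lambda>G H. \<exists>S'. round_output cert gt G S' \<and> S' \<noteq> [] \<and> H = G @ S'"
  have "\<exists>G. \<forall>k. (?P (G k) \<and> (k = 0 \<longrightarrow> G k = fs)) \<and> ?Q (G k) (G (Suc k))"
  proof (rule dependent_nat_choice[of "\<lambda>k G. ?P G \<and> (k = 0 \<longrightarrow> G = fs)" "\<lambda>_. ?Q"])
    show "\<exists>G. ?P G \<and> ((0::nat) = 0 \<longrightarrow> G = fs)"
      using not_term nz by blast
  next
    fix G :: "('r, 'n, 'm) hvec list" and k :: nat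
    assume G: "?P G \<and> (k = 0 \<longrightarrow> G = fs)"
    then have "0 \<notin> set G"
      by blast
    then have "division_terminates gt G f" for f
      unfolding division_terminates_def by (rule division_terminates)
    then obtain S' where S': "round_output cert gt G S'" "S' \<noteq> []"
      "\<not> buchberger_terminates cert gt (G @ S')"
      using G buchberger_terminates.intros[where gt = gt and G = G and cert = cert] by blast
    have "?P (G @ S')"
      using S'(3) round_output_append[OF S'(1) \<open>0 \<notin> set G\<close>] G by simp
    then show "\<exists>H. (?P H \<and> (Suc k = 0 \<longrightarrow> H = fs)) \<and> ?Q G H"
      using S'(1,2) by blast
  qed
  then obtain G where P: "\<And>k. ?P (G k)" and Q: "\<And>k. ?Q (G k) (G (Suc k))" and G0: "G 0 = fs"
    by blast
  obtain S' where S': "\<And>k. round_output cert gt (G k) (S' k)" "\<And>k. S' k \<noteq> []"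
    "\<And>k. G (Suc k) = G k @ S' k"
    using Q by metis
  \<comment> \<open>The modules of leading terms along the run; their union exhausts the module \<open>MLT\<close> of \<open>fs\<close>.\<close>
  define L where "L k = submodule_gen (LT gt ` set (G k))" for k
  have "L k \<subseteq> L (Suc k)" for k
    unfolding L_def S'(3) by (intro hvec.span_mono) auto
  then have L_mono: "L j \<subseteq> L k" if "j \<le> k" for j k
    using that by (rule lift_Suc_mono_le)
  have LT_in: "\<exists>k. LT gt u \<in> L k" if u: "u \<in> ?U" for u
  proof (cases "u = 0")
    case True
    then show ?thesis by (simp add: LT_def L_def hvec.span_zero)
  next
    case False
    show ?thesis
      unfolding L_def
    proof (rule chain_leading_terms[where G = G and G' = S', OF cert _ S'(3)])
      show "0 \<notin> set (G k)" for k
        using P by blast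
      show "rep (G (Suc k)) (gt \<delta>) (lin_comb S (G k))"
        if "S \<in> set (LT_syzygies cert gt (G k))" "\<And>M. vcoeff (lin_comb S (G k)) M \<noteq> 0 \<Longrightarrow> gt \<delta> M"
        for k S \<delta>
        unfolding S'(3) using P that by (intro round_output_rep[OF S'(1)]) auto
    qed (use u False G0 in auto)
  qed
  have "hvec.subspace (\<Union>k. L k)"
  proof (rule hvec.subspaceI)
    show "0 \<in> (\<Union>k. L k)"
      by (simp add: L_def hvec.span_zero)
    show "c *s x \<in> (\<Union>k. L k)" if "x \<in> (\<Union>k. L k)" for c x
      using that by (auto simp: L_def intro: hvec.span_scale)
    show "x + y \<in> (\<Union>k. L k)" if xy: "x \<in> (\<Union>k. L k)" "y \<in> (\<Union>k. L k)" for x y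
    proof -
      obtain i j where "x \<in> L i" "y \<in> L j"
        using xy by blast
      then have "x \<in> L (max i j)" "y \<in> L (max i j)"
        using L_mono[of i "max i j"] L_mono[of j "max i j"] by auto
      then show ?thesis
        unfolding L_def using hvec.span_add by blast
    qed
  qed
  then have MLT_sub: "MLT gt ?U \<subseteq> (\<Union>k. L k)"
    unfolding MLT_def using LT_in by (intro hvec.span_minimal) auto
  obtain B where B: "finite B" "MLT gt ?U = submodule_gen B"
    using fg unfolding finitely_generated_def by blast
  have "\<exists>K. B \<subseteq> L K"
  proof -
    have "B \<subseteq> (\<Union>k. L k)"
      using MLT_sub unfolding B(2) by (metis hvec.span_superset subset_trans)
    then obtain k where k: "\<And>b. b \<in> B \<Longrightarrow> b \<in> L (k b)"
      by (metis UN_E subsetD)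
    have "b \<in> L (Max (k ` B))" if "b \<in> B" for b
      using k[OF that] L_mono[of "k b" "Max (k ` B)"] that B(1) by auto
    then show ?thesis by blast
  qed
  then obtain K where "B \<subseteq> L K" ..
  then have stable: "MLT gt ?U \<subseteq> L K"
    unfolding B(2) L_def by (intro hvec.span_minimal) (auto simp: hvec.subspace_span)
  obtain r where r: "r \<in> set (S' K)"
    using S'(2)[of K] by (cases "S' K") auto
  obtain f where "is_remainder gt (G K) f r" "r \<noteq> 0"
    using round_output_member[OF S'(1) r] by blast
  then have "LT gt r \<notin> L K"
    unfolding L_def using P by (intro remainder_LT_notin) auto
  moreover have "r \<in> ?U"
    using P[of "Suc K"] r S'(3)[of K] hvec.span_base[of r "set (G (Suc K))"] by auto
  then have "LT gt r \<in> MLT gt ?U"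
    unfolding MLT_def by (intro hvec.span_base) simp
  ultimately show False
    using stable by blast
qed

end

theorem mainTheorem2:
  fixes test :: "'r::comm_ring_1 \<Rightarrow> 'r list \<Rightarrow> 'r list option"
    and cert :: "nat set \<Rightarrow> (nat \<Rightarrow> 'r) \<Rightarrow> (nat \<Rightarrow> 'r) list"
    and gt :: "('n::finite, 'm::finite) mono \<Rightarrow> ('n, 'm) mono \<Rightarrow> bool"
    and fs :: "('r, 'n, 'm) hvec list"
  assumes "strongly_discrete test"
    and "coherence_certificate cert"
    and "monomial_order gt"
    and "fs \<noteq> []"
    and "0 \<notin> set fs"
  shows
    "((\<exists>rs. list_all2 (\<lambda>S r. is_remainder gt fs (lin_comb S fs) r) (LT_syzygies cert gt fs) rs) \<and>
      (\<forall>rs. list_all2 (\<lambda>S r. is_remainder gt fs (lin_comb S fs) r) (LT_syzygies cert gt fs) rs \<longrightarrow>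
        (groebner_basis gt fs (submodule_gen (set fs)) \<longleftrightarrow> (\<forall>i<length rs. rs ! i = 0))))
     \<and>
     (finitely_generated (MLT gt (submodule_gen (set fs))) \<longrightarrow>
        buchberger_terminates cert gt fs \<and>
        (\<exists>G. buchberger_returns cert gt fs G) \<and>
        (\<forall>G. buchberger_returns cert gt fs G \<longrightarrow> groebner_basis gt G (submodule_gen (set fs))))"
proof -
  interpret mono_order gt
    by unfold_locales (rule assms(3))
  show ?thesis
    using remainders_exist[OF assms(5), of "\<lambda>S. lin_comb S fs" "LT_syzygies cert gt fs"]
      groebner_basis_iff_remainders_zero[OF assms(2,5)]
      buchberger_terminates_if_MLT_fg[OF assms(2,5)] buchberger_returns_exists[OF _ assms(5), of cert]
      buchberger_returns_groebner[OF assms(2) _ assms(5)]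
    by (intro conjI allI impI) simp_all
qed

end
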